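(* There is no class $\mathcal{P}$ of function clones such that (i) whenever $\mathscr{A}\in\mathcal{P}$ and $\xi:\mathscr{A}\to\mathscr{B}$ is a uniformly continuous clone homomorphism then $\mathscr{B}\in\mathcal{P}$, and (ii) for every temporal structure $\mathfrak{B}$, $\mathrm{CSP}(\mathfrak{B})$ is expressible in Datalog if and only if $\mathrm{Pol}(\mathfrak{B})\in\mathcal{P}$. That is, no condition preserved by uniformly continuous clone homomorphisms captures the expressibility of temporal CSPs in Datalog.
   Context: A temporal structure is a relational structure with domain $\mathbb{Q}$ and a finite relational signature all of whose relations are first-order definable in $(\mathbb{Q};<)$. $\mathrm{CSP}(\mathfrak{B})$ is the class of finite structures in the signature of $\mathfrak{B}$ admitting a homomorphism to $\mathfrak{B}$; it is expressible in Datalog (the existential positive fragment of least fixed-point logic) if some Datalog sentence holds exactly in the finite structures admitting no homomorphism to $\mathfrak{B}$. $\mathrm{Pol}(\mathfrak{B})$ is the clone of all polymorphisms of $\mathfrak{B}$ (operations $f:\mathbb{Q}^n\to\mathbb{Q}$ that, applied componentwise, map tuples of each relation into that relation). A clone over a set $A$ is a set of finitary operations on $A$ containing all projections and closed under composition. A map $\xi:\mathscr{A}\to\mathscr{B}$ between clones (over $A$ and $B$) is a clone homomorphism if it preserves arities and projections and satisfies $\xi(f(g_1,\dots,g_n))=\xi(f)(\xi(g_1),\dots,\xi(g_n))$; it is uniformly continuous if for every finite $B'\subseteq B$ there is a finite $A'\subseteq A$ such that whenever $f,g\in\mathscr{A}$ of the same arity agree on $A'$, then $\xi(f)$ and $\xi(g)$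 agree on $B'$. *)

theory Defs
  imports Complex_Main "HOL-Library.FuncSet"
begin

definition tuples :: "'a set \<Rightarrow> nat \<Rightarrow> 'a list set" where
  "tuples A n = {xs. length xs = n \<and> set xs \<subseteq> A}"


section \<open>Relational structures\<close>

text \<open>The signature is a partial map from relation symbols to arities; the values of \<open>rel\<close> at
  symbols outside the signature are irrelevant.\<close>

record ('r, 'a) struct =
  signat :: "'r \<Rightarrow> nat option"
  carrier :: "'a set"
  rel :: "'r \<Rightarrow> 'a list set"

definition is_struct :: "('r, 'a) struct \<Rightarrow> bool" where
  "is_struct M \<longleftrightarrow> (\<forall>R n. signat M R = Some n \<longrightarrow> rel M R \<subseteq> tuples (carrier M) n)"

definition struct_hom :: "('r, 'a) struct \<Rightarrow> ('r, 'b) struct \<Rightarrow> ('a \<Rightarrow> 'b) \<Rightarrow> bool" where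
  "struct_hom M N h \<longleftrightarrow>
     signat M = signat N \<and> h ` carrier M \<subseteq> carrier N \<and>
     (\<forall>R n. signat M R = Some n \<longrightarrow> (\<forall>t \<in> rel M R. map h t \<in> rel N R))"

text \<open>Finite structures are taken, up to isomorphism, with carrier a finite set of naturals.\<close>

definition finite_structs :: "('r \<Rightarrow> nat option) \<Rightarrow> ('r, nat) struct set" where
  "finite_structs \<tau> = {M. is_struct M \<and> signat M = \<tau> \<and> finite (carrier M)}"

definition CSP :: "('r, 'a) struct \<Rightarrow> ('r, nat) struct set" where
  "CSP B = {M \<in> finite_structs (signat B). \<exists>h. struct_hom M B h}"


section \<open>First-order logic, least fixed-point logic and Datalog\<close>

text \<open>First-order variables and relation variables are both numbered by naturals.
  \<open>Lfp X xs \<phi> ys\<close> is the formula \<open>[lfp X xs. \<phi>](ys)\<close>. Universal quantification is expressed by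
  \<open>Neg\<close> and \<open>Ex\<close>.\<close>

datatype 'r formula =
    Bot
  | Eq nat nat
  | Atom 'r "nat list"
  | RelVar nat "nat list"
  | Neg "'r formula"
  | Conj "'r formula" "'r formula"
  | Disj "'r formula" "'r formula"
  | Ex nat "'r formula"
  | Lfp nat "nat list" "'r formula" "nat list"

text \<open>The second argument of \<open>wf_formula\<close> gives the arities of the relation variables that may
  occur free.\<close>

primrec wf_formula :: "('r \<Rightarrow> nat option) \<Rightarrow> (nat \<Rightarrow> nat option) \<Rightarrow> 'r formula \<Rightarrow> bool" where
  "wf_formula \<tau> \<Gamma> Bot = True"
| "wf_formula \<tau> \<Gamma> (Eq x y) = True"
| "wf_formula \<tau> \<Gamma> (Atom R xs) = (\<tau> R = Some (length xs))"
| "wf_formula \<tau> \<Gamma> (RelVar X xs) = (\<Gamma> X = Some (length xs))"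
| "wf_formula \<tau> \<Gamma> (Neg \<phi>) = wf_formula \<tau> \<Gamma> \<phi>"
| "wf_formula \<tau> \<Gamma> (Conj \<phi> \<psi>) = (wf_formula \<tau> \<Gamma> \<phi> \<and> wf_formula \<tau> \<Gamma> \<psi>)"
| "wf_formula \<tau> \<Gamma> (Disj \<phi> \<psi>) = (wf_formula \<tau> \<Gamma> \<phi> \<and> wf_formula \<tau> \<Gamma> \<psi>)"
| "wf_formula \<tau> \<Gamma> (Ex x \<phi>) = wf_formula \<tau> \<Gamma> \<phi>"
| "wf_formula \<tau> \<Gamma> (Lfp X xs \<phi> ys) =
     (distinct xs \<and> length ys = length xs \<and> wf_formula \<tau> (\<Gamma>(X \<mapsto> length xs)) \<phi>)"

primrec free_vars :: "'r formula \<Rightarrow> nat set" where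
  "free_vars Bot = {}"
| "free_vars (Eq x y) = {x, y}"
| "free_vars (Atom R xs) = set xs"
| "free_vars (RelVar X xs) = set xs"
| "free_vars (Neg \<phi>) = free_vars \<phi>"
| "free_vars (Conj \<phi> \<psi>) = free_vars \<phi> \<union> free_vars \<psi>"
| "free_vars (Disj \<phi> \<psi>) = free_vars \<phi> \<union> free_vars \<psi>"
| "free_vars (Ex x \<phi>) = free_vars \<phi> - {x}"
| "free_vars (Lfp X xs \<phi> ys) = (free_vars \<phi> - set xs) \<union> set ys"

definition upd_list :: "(nat \<Rightarrow> 'a) \<Rightarrow> nat list \<Rightarrow> 'a list \<Rightarrow> nat \<Rightarrow> 'a" where
  "upd_list e xs vs = (\<lambda>x. case map_of (zip xs vs) x of Some v \<Rightarrow> v | None \<Rightarrow> e x)"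

text \<open>The operator below \<open>lfp\<close> is monotone for the formulas used here, namely those in the
  existential positive fragment; see \<open>existential_positive_mono\<close>.\<close>

primrec sat :: "('r, 'a) struct \<Rightarrow> (nat \<Rightarrow> 'a list set) \<Rightarrow> (nat \<Rightarrow> 'a) \<Rightarrow> 'r formula \<Rightarrow> bool" where
  "sat M I e Bot = False"
| "sat M I e (Eq x y) = (e x = e y)"
| "sat M I e (Atom R xs) = (map e xs \<in> rel M R)"
| "sat M I e (RelVar X xs) = (map e xs \<in> I X)"
| "sat M I e (Neg \<phi>) = (\<not> sat M I e \<phi>)"
| "sat M I e (Conj \<phi> \<psi>) = (sat M I e \<phi> \<and> sat M I e \<psi>)"
| "sat M I e (Disj \<phi> \<psi>) = (sat M I e \<phi> \<or> sat M I e \<psi>)"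
| "sat M I e (Ex x \<phi>) = (\<exists>a \<in> carrier M. sat M I (e(x := a)) \<phi>)"
| "sat M I e (Lfp X xs \<phi> ys) =
     (map e ys \<in> lfp (\<lambda>S. {vs \<in> tuples (carrier M) (length xs).
                              sat M (I(X := S)) (upd_list e xs vs) \<phi>}))"

primrec first_order :: "'r formula \<Rightarrow> bool" where
  "first_order Bot = True"
| "first_order (Eq x y) = True"
| "first_order (Atom R xs) = True"
| "first_order (RelVar X xs) = False"
| "first_order (Neg \<phi>) = first_order \<phi>"
| "first_order (Conj \<phi> \<psi>) = (first_order \<phi> \<and> first_order \<psi>)"
| "first_order (Disj \<phi> \<psi>) = (first_order \<phi> \<and> first_order \<psi>)"
| "first_order (Ex x \<phi>) = first_order \<phi>"
| "first_order (Lfp X xs \<phi> ys) = False"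

primrec existential_positive :: "'r formula \<Rightarrow> bool" where
  "existential_positive Bot = True"
| "existential_positive (Eq x y) = True"
| "existential_positive (Atom R xs) = True"
| "existential_positive (RelVar X xs) = True"
| "existential_positive (Neg \<phi>) = False"
| "existential_positive (Conj \<phi> \<psi>) = (existential_positive \<phi> \<and> existential_positive \<psi>)"
| "existential_positive (Disj \<phi> \<psi>) = (existential_positive \<phi> \<and> existential_positive \<psi>)"
| "existential_positive (Ex x \<phi>) = existential_positive \<phi>"
| "existential_positive (Lfp X xs \<phi> ys) = existential_positive \<phi>"

lemma existential_positive_mono:
  assumes "existential_positive \<phi>" and "sat M I e \<phi>" and "\<And>X. I X \<subseteq> J X"
  shows "sat M J e \<phi>"
  using assms
proof (induction \<phi> arbitrary: I J e)
  case (Lfp X xs \<phi> ys)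
  have "lfp (\<lambda>S. {vs \<in> tuples (carrier M) (length xs). sat M (I(X := S)) (upd_list e xs vs) \<phi>})
      \<subseteq> lfp (\<lambda>S. {vs \<in> tuples (carrier M) (length xs). sat M (J(X := S)) (upd_list e xs vs) \<phi>})"
  proof (rule lfp_mono)
    fix S
    have "sat M (J(X := S)) e' \<phi>" if "sat M (I(X := S)) e' \<phi>" for e'
    proof (rule Lfp.IH[OF _ that])
      show "existential_positive \<phi>" using Lfp.prems by simp
      show "(I(X := S)) Y \<subseteq> (J(X := S)) Y" for Y using Lfp.prems(3)[of Y] by simp
    qed
    then show "{vs \<in> tuples (carrier M) (length xs). sat M (I(X := S)) (upd_list e xs vs) \<phi>}
        \<subseteq> {vs \<in> tuples (carrier M) (length xs). sat M (J(X := S)) (upd_list e xs vs) \<phi>}"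
      by blast
  qed
  then show ?case using Lfp.prems by auto
next
  case (Ex x \<phi>)
  then show ?case by (metis existential_positive.simps(8) sat.simps(8))
next
  case (Conj \<phi> \<psi>)
  then show ?case by (metis existential_positive.simps(6) sat.simps(6))
next
  case (Disj \<phi> \<psi>)
  then show ?case by (metis existential_positive.simps(7) sat.simps(7))
qed auto

definition datalog_sentence :: "('r \<Rightarrow> nat option) \<Rightarrow> 'r formula \<Rightarrow> bool" where
  "datalog_sentence \<tau> \<phi> \<longleftrightarrow>
     existential_positive \<phi> \<and> wf_formula \<tau> Map.empty \<phi> \<and> free_vars \<phi> = {}"

text \<open>For sentences the choice of the two assignments is immaterial.\<close>

definition models :: "('r, 'a) struct \<Rightarrow> 'r formula \<Rightarrow> bool" where
  "models M \<phi> \<longleftrightarrow> sat M (\<lambda>_. {}) (\<lambda>_. undefined) \<phi>"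

definition CSP_in_Datalog :: "('r, 'a) struct \<Rightarrow> bool" where
  "CSP_in_Datalog B \<longleftrightarrow>
     (\<exists>\<phi>. datalog_sentence (signat B) \<phi> \<and>
          (\<forall>M \<in> finite_structs (signat B). models M \<phi> \<longleftrightarrow> M \<notin> CSP B))"

definition fo_definable :: "('r, 'a) struct \<Rightarrow> nat \<Rightarrow> 'a list set \<Rightarrow> bool" where
  "fo_definable M k S \<longleftrightarrow>
     (\<exists>\<phi>. first_order \<phi> \<and> wf_formula (signat M) Map.empty \<phi> \<and> free_vars \<phi> \<subseteq> {..<k} \<and>
          S = {vs \<in> tuples (carrier M) k. sat M (\<lambda>_. {}) (\<lambda>i. vs ! i) \<phi>})"


section \<open>Temporal structures\<close>

text \<open>The type \<open>'u\<close> is the universe containing the base sets of all the clones under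
  consideration; the rationals are placed in it by an injection \<open>q\<close>, which can be the identity
  when \<open>'u\<close> is \<open>rat\<close>.\<close>

definition rat_order :: "(rat \<Rightarrow> 'u) \<Rightarrow> (unit, 'u) struct" where
  "rat_order q = \<lparr>signat = (\<lambda>_. Some 2), carrier = range q, rel = (\<lambda>_. {[q x, q y] | x y. x < y})\<rparr>"

definition temporal_struct :: "(rat \<Rightarrow> 'u) \<Rightarrow> ('r, 'u) struct \<Rightarrow> bool" where
  "temporal_struct q B \<longleftrightarrow>
     finite (dom (signat B)) \<and> carrier B = range q \<and>
     (\<forall>R k. signat B R = Some k \<longrightarrow> fo_definable (rat_order q) k (rel B R))"


section \<open>Function clones\<close>

text \<open>Operations have arity at least 1, and an \<open>n\<close>-ary operation on \<open>A\<close> is an extensional function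
  on \<open>tuples A n\<close>. The set of operations of a clone is graded by arity.\<close>

record 'a clone =
  base :: "'a set"
  ops :: "nat \<Rightarrow> ('a list \<Rightarrow> 'a) set"

definition proj :: "'a set \<Rightarrow> nat \<Rightarrow> nat \<Rightarrow> 'a list \<Rightarrow> 'a" where
  "proj A n i = restrict (\<lambda>xs. xs ! i) (tuples A n)"

definition compose_ops :: "'a set \<Rightarrow> nat \<Rightarrow> ('a list \<Rightarrow> 'a) \<Rightarrow> ('a list \<Rightarrow> 'a) list \<Rightarrow> 'a list \<Rightarrow> 'a" where
  "compose_ops A m f gs = restrict (\<lambda>xs. f (map (\<lambda>g. g xs) gs)) (tuples A m)"

definition function_clone :: "'a clone \<Rightarrow> bool" where
  "function_clone \<A> \<longleftrightarrow>
     ops \<A> 0 = {} \<and>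
     (\<forall>n. ops \<A> n \<subseteq> tuples (base \<A>) n \<rightarrow>\<^sub>E base \<A>) \<and>
     (\<forall>n. \<forall>i<n. proj (base \<A>) n i \<in> ops \<A> n) \<and>
     (\<forall>n m f gs. f \<in> ops \<A> n \<and> length gs = n \<and> set gs \<subseteq> ops \<A> m \<longrightarrow>
        compose_ops (base \<A>) m f gs \<in> ops \<A> m)"

definition clone_hom ::
  "'a clone \<Rightarrow> 'b clone \<Rightarrow> (nat \<Rightarrow> ('a list \<Rightarrow> 'a) \<Rightarrow> ('b list \<Rightarrow> 'b)) \<Rightarrow> bool" where
  "clone_hom \<A> \<B> \<xi> \<longleftrightarrow>
     (\<forall>n. \<xi> n ` ops \<A> n \<subseteq> ops \<B> n) \<and>
     (\<forall>n. \<forall>i<n. \<xi> n (proj (base \<A>) n i) = proj (base \<B>) n i) \<and>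
     (\<forall>n m f gs. f \<in> ops \<A> n \<and> length gs = n \<and> set gs \<subseteq> ops \<A> m \<longrightarrow>
        \<xi> m (compose_ops (base \<A>) m f gs) = compose_ops (base \<B>) m (\<xi> n f) (map (\<xi> m) gs))"

definition uniformly_cont ::
  "'a clone \<Rightarrow> 'b clone \<Rightarrow> (nat \<Rightarrow> ('a list \<Rightarrow> 'a) \<Rightarrow> ('b list \<Rightarrow> 'b)) \<Rightarrow> bool" where
  "uniformly_cont \<A> \<B> \<xi> \<longleftrightarrow>
     (\<forall>B'. finite B' \<and> B' \<subseteq> base \<B> \<longrightarrow>
        (\<exists>A'. finite A' \<and> A' \<subseteq> base \<A> \<and>
           (\<forall>n. \<forall>f \<in> ops \<A> n. \<forall>g \<in> ops \<A> n.
              (\<forall>xs \<in> tuples A' n. f xs = g xs) \<longrightarrow> (\<forall>xs \<in> tuples B' n. \<xi> n f xs = \<xi> n g xs))))"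

definition polymorphism :: "('r, 'a) struct \<Rightarrow> nat \<Rightarrow> ('a list \<Rightarrow> 'a) \<Rightarrow> bool" where
  "polymorphism B n f \<longleftrightarrow>
     n \<ge> 1 \<and> f \<in> tuples (carrier B) n \<rightarrow>\<^sub>E carrier B \<and>
     (\<forall>R k ts. signat B R = Some k \<and> length ts = n \<and> set ts \<subseteq> rel B R \<longrightarrow>
        map (\<lambda>j. f (map (\<lambda>t. t ! j) ts)) [0..<k] \<in> rel B R)"

definition Pol :: "('r, 'a) struct \<Rightarrow> 'a clone" where
  "Pol B = \<lparr>base = carrier B, ops = (\<lambda>n. {f. polymorphism B n f})\<rparr>"

lemma temporal_struct_is_struct: "temporal_struct q B \<Longrightarrow> is_struct B"
  unfolding temporal_struct_def is_struct_def fo_definable_def rat_order_def by fastforce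

lemma function_clone_Pol:
  assumes "is_struct B"
  shows "function_clone (Pol B)"
proof -
  let ?C = "carrier B"
  have len: "length t = k \<and> set t \<subseteq> ?C" if "signat B R = Some k" "t \<in> rel B R" for R k t
    using assms that unfolding is_struct_def tuples_def by blast
  have row: "map (\<lambda>t. t ! j) ts \<in> tuples ?C (length ts)"
    if "signat B R = Some k" "set ts \<subseteq> rel B R" "j < k" for R k ts j
    using len[OF that(1)] that(2,3) unfolding tuples_def by fastforce
  have proj: "polymorphism B n (proj ?C n i)" if "i < n" for n i
  proof -
    have "map (\<lambda>j. proj ?C n i (map (\<lambda>t. t ! j) ts)) [0..<k] = ts ! i"
      if *: "signat B R = Some k" "length ts = n" "set ts \<subseteq> rel B R" for R k ts
    proof (rule nth_equalityI)
      show l: "length (map (\<lambda>j. proj ?C n i (map (\<lambda>t. t ! j) ts)) [0..<k]) = length (ts ! i)"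
        using len[OF *(1), of "ts ! i"] * \<open>i < n\<close> by (auto dest: nth_mem)
      show "map (\<lambda>j. proj ?C n i (map (\<lambda>t. t ! j) ts)) [0..<k] ! j = ts ! i ! j"
        if "j < length (map (\<lambda>j. proj ?C n i (map (\<lambda>t. t ! j) ts)) [0..<k])" for j
        using row[OF *(1,3), of j] that * \<open>i < n\<close> by (simp add: proj_def)
    qed
    moreover have "proj ?C n i \<in> tuples ?C n \<rightarrow>\<^sub>E ?C"
      using \<open>i < n\<close> by (auto simp: proj_def tuples_def dest: nth_mem)
    ultimately show ?thesis
      using \<open>i < n\<close> unfolding polymorphism_def by (auto simp: subset_iff)
  qed
  have comp: "polymorphism B m (compose_ops ?C m f gs)"
    if f: "polymorphism B n f" and gs: "length gs = n" "\<And>g. g \<in> set gs \<Longrightarrow> polymorphism B m g"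
    for n m f gs
  proof -
    have m: "m \<ge> 1"
      using f gs unfolding polymorphism_def
      by (metis One_nat_def Suc_le_eq nth_mem)
    have inner: "map (\<lambda>g. g xs) gs \<in> tuples ?C n" if "xs \<in> tuples ?C m" for xs
      using gs that unfolding tuples_def polymorphism_def by auto
    have "compose_ops ?C m f gs \<in> tuples ?C m \<rightarrow>\<^sub>E ?C"
      using f inner unfolding polymorphism_def compose_ops_def by auto
    moreover have "map (\<lambda>j. compose_ops ?C m f gs (map (\<lambda>t. t ! j) ts)) [0..<k] \<in> rel B R"
      if *: "signat B R = Some k" "length ts = m" "set ts \<subseteq> rel B R" for R k ts
    proof -
      define us where "us = map (\<lambda>g. map (\<lambda>j. g (map (\<lambda>t. t ! j) ts)) [0..<k]) gs"
      have "set us \<subseteq> rel B R" "length us = n"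
        using gs * unfolding us_def polymorphism_def by auto
      then have "map (\<lambda>j. f (map (\<lambda>t. t ! j) us)) [0..<k] \<in> rel B R"
        using f *(1) unfolding polymorphism_def by blast
      moreover have "map (\<lambda>j. f (map (\<lambda>t. t ! j) us)) [0..<k] =
          map (\<lambda>j. compose_ops ?C m f gs (map (\<lambda>t. t ! j) ts)) [0..<k]"
        using row[OF *(1,3)] * by (auto simp: us_def compose_ops_def comp_def)
      ultimately show ?thesis by simp
    qed
    ultimately show ?thesis using m unfolding polymorphism_def by blast
  qed
  show ?thesis
    unfolding function_clone_def Pol_def
    using proj comp by (auto simp: polymorphism_def[of B 0] subset_iff) (auto simp: polymorphism_def)
qed

end

theory Submission
  imports Defs "HOL-Library.Countable"
begin

text \<open>A polymorphism \<open>f\<close> of the structure with the relations \<open>a \<noteq> b\<close> and \<open>a = b \<longrightarrow> c = d\<close> has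
  \<open>f xs = f ys\<close> exactly if \<open>xs\<close> and \<open>ys\<close> agree on the set \<open>S\<close> of essential arguments of \<open>f\<close>.
  Hence \<open>S\<close> behaves under composition like the set of arguments of a semilattice term, and mapping
  \<open>f\<close> to the minimum over the arguments in \<open>S\<close> is a clone homomorphism. It is uniformly continuous
  because \<open>S\<close> can be read off from the values of \<open>f\<close> on two elements. The minimum preserves the
  relation \<open>x > y \<or> x > z\<close>, so the first structure, whose CSP is solved by computing an equivalence
  closure in Datalog, is mapped to one whose CSP is not in Datalog.

  For the latter, consider the unsatisfiable instance on an \<open>n \<times> n\<close> torus in which \<open>(i, j)\<close> must lie
  above \<open>(i + 1, j)\<close> or \<open>(i, j + 1)\<close>. In the existential pebble game, a duplicator who maintains a
  solution on \<open>C \<times> C\<close> for the set \<open>C\<close> of pebbled coordinates survives as long as \<open>C\<close> is proper.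
  So a Datalog sentence that holds in a large torus also holds in the infinite template, hence in a
  finite substructure of it, which is satisfiable.\<close>

section \<open>Least fixed points and finite substructures\<close>

lemma finite_free_vars: "finite (free_vars \<phi>)"
  by (induction \<phi>) auto

lemma upd_list_notin:
  assumes "v \<notin> set xs" "length vs = length xs"
  shows "upd_list e xs vs v = e v"
proof -
  have "map_of (zip xs vs) v = None"
    using assms by simp
  then show ?thesis by (simp add: upd_list_def)
qed

lemma upd_list_in:
  assumes "v \<in> set xs" "length vs = length xs"
  shows "upd_list e xs vs v \<in> set vs" "upd_list e' xs (map f vs) v = f (upd_list e xs vs v)"
proof -
  obtain a where a: "map_of (zip xs vs) v = Some a"
    using assms by (metis map_of_zip_is_Some)
  moreover have "a \<in> set vs"
    using map_of_SomeD[OF a] by (rule set_zip_rightD)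
  moreover have "map_of (zip xs (map f vs)) v = Some (f a)"
    using a by (simp add: zip_map2 map_of_map)
  ultimately show "upd_list e xs vs v \<in> set vs" "upd_list e' xs (map f vs) v = f (upd_list e xs vs v)"
    by (simp_all add: upd_list_def)
qed

text \<open>Spelled exactly as in the \<open>Lfp\<close> clause of \<open>sat\<close>, so that facts
  about the operator apply once \<open>sat\<close> is unfolded.\<close>

abbreviation lfp_op ::
  "('r, 'a) struct \<Rightarrow> (nat \<Rightarrow> 'a list set) \<Rightarrow> (nat \<Rightarrow> 'a) \<Rightarrow> nat \<Rightarrow> nat list \<Rightarrow> 'r formula \<Rightarrow> 'a list set \<Rightarrow> 'a list set"
  where "lfp_op M I e X xs \<phi> S \<equiv>
    {vs \<in> tuples (carrier M) (length xs). sat M (I(X := S)) (upd_list e xs vs) \<phi>}"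

lemma mono_lfp_op: "existential_positive \<phi> \<Longrightarrow> mono (lfp_op M I e X xs \<phi>)"
  by (rule monoI, rule subsetI, rule CollectI)
    (auto elim!: existential_positive_mono split: if_splits)

lemma lfp_op_unfold:
  assumes "existential_positive \<phi>"
  shows "lfp_op M I e X xs \<phi> (lfp (lfp_op M I e X xs \<phi>)) = lfp (lfp_op M I e X xs \<phi>)"
  by (rule lfp_unfold[OF mono_lfp_op[OF assms], symmetric])

text \<open>Without negation, existential witnesses survive in the larger structure and fixed-point
  operators grow pointwise, so \<open>lfp_mono\<close> applies. Used to pass to larger
  substructures.\<close>

lemma existential_positive_mono_struct:
  assumes "existential_positive \<phi>" and "sat M I e \<phi>"
    and "carrier M \<subseteq> carrier N" and "\<And>R. rel M R \<subseteq> rel N R" and "\<And>X. I X \<subseteq> J X"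
  shows "sat N J e \<phi>"
  using assms
proof (induction \<phi> arbitrary: I J e)
  case (Lfp X xs \<phi> ys)
  have "lfp (lfp_op M I e X xs \<phi>) \<subseteq> lfp (lfp_op N J e X xs \<phi>)"
  proof (rule lfp_mono)
    fix S
    have "sat N (J(X := S)) e' \<phi>" if "sat M (I(X := S)) e' \<phi>" for e'
      by (rule Lfp.IH[OF _ that]) (use Lfp.prems in auto)
    then show "lfp_op M I e X xs \<phi> S \<subseteq> lfp_op N J e X xs \<phi> S"
      using Lfp.prems(3) by (auto simp: tuples_def)
  qed
  then show ?case using Lfp.prems by auto
next
  case (Ex x \<phi>)
  then show ?case by (metis existential_positive.simps(8) sat.simps(8) subsetD)
next
  case (Conj \<phi> \<psi>)
  then show ?case by (metis existential_positive.simps(6) sat.simps(6))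
next
  case (Disj \<phi> \<psi>)
  then show ?case by (metis existential_positive.simps(7) sat.simps(7))
next
  case (RelVar X xs)
  then show ?case by (metis sat.simps(4) subsetD)
qed auto

section \<open>Compactness for finite substructures\<close>

definition substruct :: "('r, 'a) struct \<Rightarrow> 'a set \<Rightarrow> ('r, 'a) struct" where
  "substruct M A = \<lparr>signat = signat M, carrier = A, rel = (\<lambda>R. rel M R \<inter> lists A)\<rparr>"

lemma substruct_simps [simp]:
  "signat (substruct M A) = signat M" "carrier (substruct M A) = A"
  "rel (substruct M A) R = rel M R \<inter> lists A"
  by (simp_all add: substruct_def)

lemma sat_substruct_mono:
  assumes "existential_positive \<phi>" "sat (substruct M A) I e \<phi>" "A \<subseteq> B" "\<And>X. I X \<subseteq> J X"
  shows "sat (substruct M B) J e \<phi>"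
  using assms(1,2) by (rule existential_positive_mono_struct) (use assms(3,4) in auto)

text \<open>Evaluating an existential positive formula touches only finitely many elements. Relation
  variables are interpreted by the union of a monotone family \<open>J\<close>, a form that survives
  nesting: a fixed point on \<open>M\<close> is contained in the union of the fixed points on finite
  substructures.\<close>

lemma sat_finite_substruct:
  assumes "existential_positive \<phi>" and "\<And>R. rel M R \<subseteq> lists (carrier M)"
    and "\<And>A B X. A \<subseteq> B \<Longrightarrow> J A X \<subseteq> J B X"
    and "sat M (\<lambda>X. \<Union>A \<in> {A. finite A \<and> A \<subseteq> carrier M}. J A X) e \<phi>"
  shows "\<exists>A. finite A \<and> A \<subseteq> carrier M \<and> sat (substruct M A) (J A) e \<phi>"
  using assms
proof (induction \<phi> arbitrary: J e)
  case (Eq x y)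
  then show ?case by (intro exI[of _ "{}"]) auto
next
  case (Atom R xs)
  then have "map e xs \<in> lists (carrier M)" by (meson sat.simps(3) subsetD)
  then have "set (map e xs) \<subseteq> carrier M" by (simp add: lists_eq_set)
  then show ?case using Atom
    by (intro exI[of _ "set (map e xs)"]) auto
next
  case (RelVar X xs)
  then show ?case by auto
next
  case (Conj \<phi> \<psi>)
  obtain A where A: "finite A" "A \<subseteq> carrier M" "sat (substruct M A) (J A) e \<phi>"
    using Conj.IH(1)[where J = J and e = e, OF _ Conj.prems(2,3)] Conj.prems(1,4) by auto
  obtain B where B: "finite B" "B \<subseteq> carrier M" "sat (substruct M B) (J B) e \<psi>"
    using Conj.IH(2)[where J = J and e = e, OF _ Conj.prems(2,3)] Conj.prems(1,4) by auto
  have "sat (substruct M (A \<union> B)) (J (A \<union> B)) e \<phi>" "sat (substruct M (A \<union> B)) (J (A \<union> B)) e \<psi>"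
    by (rule sat_substruct_mono[OF _ A(3)] sat_substruct_mono[OF _ B(3)];
        use Conj.prems(1,3) in auto)+
  then show ?case using A B by (intro exI[of _ "A \<union> B"]) auto
next
  case (Disj \<phi> \<psi>)
  let ?I = "\<lambda>X. \<Union>A \<in> {A. finite A \<and> A \<subseteq> carrier M}. J A X"
  have "\<exists>A. finite A \<and> A \<subseteq> carrier M \<and> sat (substruct M A) (J A) e \<phi>" if "sat M ?I e \<phi>"
    using Disj.IH(1)[where J = J, OF _ Disj.prems(2,3) that] Disj.prems(1) by simp
  moreover have "\<exists>A. finite A \<and> A \<subseteq> carrier M \<and> sat (substruct M A) (J A) e \<psi>" if "sat M ?I e \<psi>"
    using Disj.IH(2)[where J = J, OF _ Disj.prems(2,3) that] Disj.prems(1) by simp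
  ultimately show ?case using Disj.prems(4) by auto
next
  case (Ex x \<phi>)
  then obtain a where a: "a \<in> carrier M"
    "sat M (\<lambda>X. \<Union>A \<in> {A. finite A \<and> A \<subseteq> carrier M}. J A X) (e(x := a)) \<phi>" by auto
  obtain A where A: "finite A" "A \<subseteq> carrier M" "sat (substruct M A) (J A) (e(x := a)) \<phi>"
    using Ex.IH[where J = J, OF _ Ex.prems(2,3) a(2)] Ex.prems(1)
    by (metis existential_positive.simps(8))
  have "sat (substruct M (insert a A)) (J (insert a A)) (e(x := a)) \<phi>"
    by (rule sat_substruct_mono[OF _ A(3) subset_insertI]) (use Ex.prems(1) Ex.prems(3)[OF subset_insertI] in simp_all)
  then show ?case using A a by (intro exI[of _ "insert a A"]) auto
next
  case (Lfp X xs \<phi> ys)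
  let ?I = "\<lambda>X. \<Union>A \<in> {A. finite A \<and> A \<subseteq> carrier M}. J A X"
  define L where "L A = lfp (lfp_op (substruct M A) (J A) e X xs \<phi>)" for A
  have ep: "existential_positive \<phi>" using Lfp.prems(1) by simp
  have L_mono: "L A \<subseteq> L B" if "A \<subseteq> B" for A B
    unfolding L_def
  proof (rule lfp_mono)
    fix S
    have "sat (substruct M B) ((J B)(X := S)) e' \<phi>" if "sat (substruct M A) ((J A)(X := S)) e' \<phi>" for e'
      by (rule sat_substruct_mono[OF ep that \<open>A \<subseteq> B\<close>]) (use Lfp.prems(3) \<open>A \<subseteq> B\<close> in auto)
    then show "lfp_op (substruct M A) (J A) e X xs \<phi> S \<subseteq> lfp_op (substruct M B) (J B) e X xs \<phi> S"
      using that by (auto simp: tuples_def)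
  qed
  \<comment> \<open>\<open>K\<close> extends the monotone family by the fixed points on the
    substructures, so the induction hypothesis applies to the body with \<open>X\<close> interpreted
    by the union \<open>S\<close>.\<close>
  define K where "K A = (J A)(X := L A)" for A
  have K_mono: "K A Y \<subseteq> K B Y" if "A \<subseteq> B" for A B Y
    using L_mono[OF that] Lfp.prems(3)[OF that] by (simp add: K_def)
  define S where "S = (\<Union>A \<in> {A. finite A \<and> A \<subseteq> carrier M}. L A)"
  have "lfp (lfp_op M ?I e X xs \<phi>) \<subseteq> S"
  proof (rule lfp_lowerbound, rule subsetI)
    fix vs assume "vs \<in> lfp_op M ?I e X xs \<phi> S"
    then have vs: "vs \<in> tuples (carrier M) (length xs)" and
      "sat M (?I(X := S)) (upd_list e xs vs) \<phi>" by auto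
    moreover have "?I(X := S) = (\<lambda>Y. \<Union>A \<in> {A. finite A \<and> A \<subseteq> carrier M}. K A Y)"
      by (rule ext) (simp add: K_def S_def)
    ultimately obtain A where A: "finite A" "A \<subseteq> carrier M"
      "sat (substruct M A) (K A) (upd_list e xs vs) \<phi>"
      using Lfp.IH[where J = K, OF ep Lfp.prems(2) K_mono] by auto
    \<comment> \<open>The entries of \<open>vs\<close> must belong to the substructure before its
      fixed point can contain \<open>vs\<close>.\<close>
    let ?B = "A \<union> set vs"
    have "sat (substruct M ?B) (K ?B) (upd_list e xs vs) \<phi>"
      by (rule sat_substruct_mono[OF ep A(3)]) (use K_mono[of A ?B] in auto)
    then have "vs \<in> lfp_op (substruct M ?B) (J ?B) e X xs \<phi> (L ?B)"
      using vs by (auto simp: K_def tuples_def)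
    then have "vs \<in> L ?B"
      unfolding L_def lfp_op_unfold[OF ep] .
    then show "vs \<in> S" using A vs by (auto simp: S_def tuples_def)
  qed
  then have "map e ys \<in> S" using Lfp.prems(4) by auto
  then show ?case by (auto simp: S_def L_def)
qed auto

section \<open>Existential pebble games\<close>

text \<open>Bounds the number of variables whose values have to be pebbled at once. Subformulas can
  reuse pebbles, hence \<open>max\<close>; a fixed point keeps its parameters pebbled while its body
  is evaluated, hence the sum in the \<open>Lfp\<close> clause.\<close>

primrec pebble_cost :: "'r formula \<Rightarrow> nat" where
  "pebble_cost Bot = 0"
| "pebble_cost (Eq x y) = 0"
| "pebble_cost (Atom R xs) = 0"
| "pebble_cost (RelVar X xs) = 0"
| "pebble_cost (Neg \<phi>) = pebble_cost \<phi>"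
| "pebble_cost (Conj \<phi> \<psi>) = max (pebble_cost \<phi>) (pebble_cost \<psi>)"
| "pebble_cost (Disj \<phi> \<psi>) = max (pebble_cost \<phi>) (pebble_cost \<psi>)"
| "pebble_cost (Ex x \<phi>) = max (card (insert x (free_vars \<phi>))) (pebble_cost \<phi>)"
| "pebble_cost (Lfp X xs \<phi> ys) = card (free_vars (Lfp X xs \<phi> ys)) + pebble_cost \<phi>"

lemma le_add_mult_max:
  fixes a d k m n :: nat
  assumes "a + d * max m n \<le> k"
  shows "a + d * m \<le> k" "a + d * n \<le> k"
proof -
  have "d * m \<le> d * max m n" "d * n \<le> d * max m n"
    by (rule mult_le_mono2, simp)+
  with assms show "a + d * m \<le> k" "a + d * n \<le> k"
    by linarith+
qed

text \<open>A strategy of the duplicator in the existential pebble game, with pebbles on coordinates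
  instead of elements: \<open>a\<close> counts as pebbled when \<open>supp a\<close> lies in
  \<open>C\<close>. The total function \<open>h\<close> stands for its restriction to such elements,
  and \<open>pos_extend\<close> combines lifting pebbles with placing new ones.\<close>

locale pebble_strategy =
  fixes M :: "('r, 'a) struct" and N :: "('r, 'b) struct"
    and supp :: "'a \<Rightarrow> 'c set" and d k :: nat
    and pos :: "'c set \<Rightarrow> ('a \<Rightarrow> 'b) \<Rightarrow> bool"
  assumes finite_supp: "finite (supp a)"
    and card_supp: "card (supp a) \<le> d"
    and pos_carrier: "pos C h \<Longrightarrow> a \<in> carrier M \<Longrightarrow> supp a \<subseteq> C \<Longrightarrow> h a \<in> carrier N"
    and pos_rel: "pos C h \<Longrightarrow> t \<in> rel M R \<Longrightarrow> (\<Union>a\<in>set t. supp a) \<subseteq> C \<Longrightarrow> map h t \<in> rel N R"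
    and pos_extend: "pos C h \<Longrightarrow> finite C' \<Longrightarrow> card C' \<le> k \<Longrightarrow>
      \<exists>h'. pos C' h' \<and> (\<forall>a. supp a \<subseteq> C \<inter> C' \<longrightarrow> h' a = h a)"
begin

lemma card_add_supp:
  assumes "finite F" "finite V"
  shows "finite (F \<union> (\<Union>v\<in>V. supp (e v)))" "card (F \<union> (\<Union>v\<in>V. supp (e v))) \<le> card F + d * card V"
proof -
  show "finite (F \<union> (\<Union>v\<in>V. supp (e v)))" using assms finite_supp by auto
  have "card (\<Union>v\<in>V. supp (e v)) \<le> (\<Sum>v\<in>V. card (supp (e v)))"
    by (rule card_UN_le[OF assms(2)])
  also have "\<dots> \<le> d * card V"
    using sum_bounded_above[of V "\<lambda>v. card (supp (e v))" d] card_supp by (simp add: mult.commute)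
  finally show "card (F \<union> (\<Union>v\<in>V. supp (e v))) \<le> card F + d * card V"
    using card_Un_le[of F "\<Union>v\<in>V. supp (e v)"] by linarith
qed

text \<open>The values of relation variables may depend on parameters that are overwritten in the current
  assignment; the set \<open>F\<close> keeps these parameters pebbled.\<close>

lemma sat_transfer:
  assumes "existential_positive \<phi>" and "pos C h"
    and "F \<subseteq> C" "finite F" "card F + d * pebble_cost \<phi> \<le> k"
    and "\<And>v. v \<in> free_vars \<phi> \<Longrightarrow> e v \<in> carrier M \<and> supp (e v) \<subseteq> C \<and> e' v = h (e v)"
    and "\<And>X C2 h2 vs. F \<subseteq> C2 \<Longrightarrow> pos C2 h2 \<Longrightarrow> (\<And>a. supp a \<subseteq> F \<Longrightarrow> h2 a = h a) \<Longrightarrow> vs \<in> I X \<Longrightarrow>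
      (\<And>a. a \<in> set vs \<Longrightarrow> a \<in> carrier M \<and> supp a \<subseteq> C2) \<Longrightarrow> map h2 vs \<in> I' X"
    and "sat M I e \<phi>"
  shows "sat N I' e' \<phi>"
  using assms
proof (induction \<phi> arbitrary: C h F e e' I I')
  case (Eq x y)
  then show ?case by auto
next
  case (Atom R xs)
  have "map h (map e xs) \<in> rel N R"
    by (rule pos_rel[OF Atom.prems(2)]) (use Atom.prems(6,8) in auto)
  moreover have "map h (map e xs) = map e' xs" using Atom.prems(6) by auto
  ultimately show ?case by (metis sat.simps(3))
next
  case (RelVar X xs)
  have "map h (map e xs) \<in> I' X"
    by (rule RelVar.prems(7)[OF RelVar.prems(3,2)]) (use RelVar.prems(6,8) in auto)
  moreover have "map h (map e xs) = map e' xs" using RelVar.prems(6) by auto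
  ultimately show ?case by (metis sat.simps(4))
next
  case (Conj \<phi> \<psi>)
  have *: "card F + d * pebble_cost \<phi> \<le> k" "card F + d * pebble_cost \<psi> \<le> k"
    using Conj.prems(5) le_add_mult_max by (metis pebble_cost.simps(6))+
  have "sat N I' e' \<phi>"
    by (rule Conj.IH(1)[OF _ Conj.prems(2-4) _ _ Conj.prems(7)])
      (use Conj.prems(1,6,8) * in auto)
  moreover have "sat N I' e' \<psi>"
    by (rule Conj.IH(2)[OF _ Conj.prems(2-4) _ _ Conj.prems(7)])
      (use Conj.prems(1,6,8) * in auto)
  ultimately show ?case by simp
next
  case (Disj \<phi> \<psi>)
  have *: "card F + d * pebble_cost \<phi> \<le> k" "card F + d * pebble_cost \<psi> \<le> k"
    using Disj.prems(5) le_add_mult_max by (metis pebble_cost.simps(7))+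
  have "sat N I' e' \<phi>" if "sat M I e \<phi>"
    by (rule Disj.IH(1)[OF _ Disj.prems(2-4) _ _ Disj.prems(7) that])
      (use Disj.prems(1,6) * in auto)
  moreover have "sat N I' e' \<psi>" if "sat M I e \<psi>"
    by (rule Disj.IH(2)[OF _ Disj.prems(2-4) _ _ Disj.prems(7) that])
      (use Disj.prems(1,6) * in auto)
  ultimately show ?case using Disj.prems(8) by auto
next
  case (Ex x \<phi>)
  then obtain a where a: "a \<in> carrier M" "sat M I (e(x := a)) \<phi>" by auto
  define C' where "C' = F \<union> (\<Union>v\<in>insert x (free_vars \<phi>). supp ((e(x := a)) v))"
  have cost: "card F + d * card (insert x (free_vars \<phi>)) \<le> k" "card F + d * pebble_cost \<phi> \<le> k"
    using Ex.prems(5) le_add_mult_max by (metis pebble_cost.simps(8))+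
  have "finite C'" "card C' \<le> k"
    using card_add_supp[OF Ex.prems(4), of "insert x (free_vars \<phi>)" "e(x := a)"]
      finite_free_vars[of \<phi>] cost(1)
    unfolding C'_def by (blast, metis finite_insert le_trans)
  then obtain h' where h': "pos C' h'" "\<And>a. supp a \<subseteq> C \<inter> C' \<Longrightarrow> h' a = h a"
    using pos_extend[OF Ex.prems(2)] by blast
  have F: "F \<subseteq> C'" by (simp add: C'_def)
  have "h' a \<in> carrier N"
    by (intro pos_carrier[OF h'(1) a(1)]) (auto simp: C'_def)
    moreover have "sat N I' (e'(x := h' a)) \<phi>"
    proof (rule Ex.IH[OF _ h'(1) F Ex.prems(4) _ _ _ a(2)])
      show "existential_positive \<phi>" "card F + d * pebble_cost \<phi> \<le> k"
        using Ex.prems(1) cost(2) by auto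
      show "(e(x := a)) v \<in> carrier M \<and> supp ((e(x := a)) v) \<subseteq> C' \<and> (e'(x := h' a)) v = h' ((e(x := a)) v)"
        if v: "v \<in> free_vars \<phi>" for v
      proof -
        have s: "supp ((e(x := a)) v) \<subseteq> C'" using v by (auto simp: C'_def)
        show ?thesis
        proof (cases "v = x")
          case False
          then have "e v \<in> carrier M" "supp (e v) \<subseteq> C" "e' v = h (e v)"
            using Ex.prems(6)[of v] v by auto
          then show ?thesis using s h'(2)[of "e v"] False by auto
        qed (use s a in auto)
      qed
      show "map h2 vs \<in> I' X" if "F \<subseteq> C2" "pos C2 h2" "\<And>a. supp a \<subseteq> F \<Longrightarrow> h2 a = h' a" "vs \<in> I X"
        "\<And>a. a \<in> set vs \<Longrightarrow> a \<in> carrier M \<and> supp a \<subseteq> C2" for X C2 h2 vs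
      proof (rule Ex.prems(7)[OF that(1,2) _ that(4,5)])
        fix a assume "supp a \<subseteq> F"
        then show "h2 a = h a" using that(3) h'(2) F Ex.prems(3) by (metis le_inf_iff subset_trans)
      qed
    qed
    ultimately show ?case by auto
next
  case (Lfp X xs \<phi> ys)
  define F' where "F' = F \<union> (\<Union>v\<in>free_vars (Lfp X xs \<phi> ys). supp (e v))"
  have F': "finite F'" "card F' \<le> card F + d * card (free_vars (Lfp X xs \<phi> ys))" "F \<subseteq> F'" "F' \<subseteq> C"
    using card_add_supp[OF Lfp.prems(4) finite_free_vars, of e "Lfp X xs \<phi> ys"] Lfp.prems(3,6)
    unfolding F'_def by auto
  have cost: "card F' + d * pebble_cost \<phi> \<le> k"
    using Lfp.prems(5) F'(2) by (simp add: distrib_left)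
  have ep: "existential_positive \<phi>" using Lfp.prems(1) by simp
  let ?L = "lfp (lfp_op N I' e' X xs \<phi>)"
  \<comment> \<open>Pebbles may have moved by the time \<open>X\<close> is used, so \<open>S\<close>
    quantifies over all positions that agree with \<open>h\<close> on \<open>F'\<close>. It bounds
    the least fixed point on \<open>M\<close> once it is shown to be closed under the
    operator.\<close>
  define S where "S = {vs. \<forall>C2 h2. F' \<subseteq> C2 \<longrightarrow> pos C2 h2 \<longrightarrow> (\<forall>a. supp a \<subseteq> F' \<longrightarrow> h2 a = h a) \<longrightarrow>
    (\<forall>a\<in>set vs. a \<in> carrier M \<and> supp a \<subseteq> C2) \<longrightarrow> map h2 vs \<in> ?L}"
  have "lfp (lfp_op M I e X xs \<phi>) \<subseteq> S"
  proof (rule lfp_lowerbound, rule subsetI)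
    fix vs assume "vs \<in> lfp_op M I e X xs \<phi> S"
    then have vs: "set vs \<subseteq> carrier M" "length vs = length xs"
      "sat M (I(X := S)) (upd_list e xs vs) \<phi>" by (auto simp: tuples_def)
    have "map h2 vs \<in> ?L" if C2: "F' \<subseteq> C2" "pos C2 h2" "\<And>a. supp a \<subseteq> F' \<Longrightarrow> h2 a = h a"
      "\<And>a. a \<in> set vs \<Longrightarrow> a \<in> carrier M \<and> supp a \<subseteq> C2" for C2 h2
    proof -
      have "sat N (I'(X := ?L)) (upd_list e' xs (map h2 vs)) \<phi>"
      proof (rule Lfp.IH[OF ep C2(2,1) F'(1) cost _ _ vs(3)])
        show "upd_list e xs vs v \<in> carrier M \<and> supp (upd_list e xs vs v) \<subseteq> C2 \<and>
            upd_list e' xs (map h2 vs) v = h2 (upd_list e xs vs v)" if v: "v \<in> free_vars \<phi>" for v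
        proof (cases "v \<in> set xs")
          case True
          then show ?thesis using C2(4) upd_list_in[OF True vs(2)] by metis
        next
          case False
          then have "v \<in> free_vars (Lfp X xs \<phi> ys)" using v by auto
          then have "e v \<in> carrier M" "e' v = h (e v)" "supp (e v) \<subseteq> F'"
            using Lfp.prems(6)[of v] by (auto simp: F'_def)
          moreover have "upd_list e xs vs v = e v" "upd_list e' xs (map h2 vs) v = e' v"
            by (simp_all add: upd_list_notin[OF False] vs(2))
          ultimately show ?thesis using C2(1,3) by auto
        qed
        show "map h3 us \<in> (I'(X := ?L)) Y" if "F' \<subseteq> C3" "pos C3 h3" "\<And>a. supp a \<subseteq> F' \<Longrightarrow> h3 a = h2 a"
          "us \<in> (I(X := S)) Y" "\<And>a. a \<in> set us \<Longrightarrow> a \<in> carrier M \<and> supp a \<subseteq> C3" for Y C3 h3 us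
        proof (cases "Y = X")
          case True
          then have "us \<in> S" using that(4) by simp
          moreover have "\<forall>a. supp a \<subseteq> F' \<longrightarrow> h3 a = h a" using that(3) C2(3) by simp
          ultimately show ?thesis using that(1,2,5) True unfolding S_def by simp
        next
          \<comment> \<open>Agreement with \<open>h\<close> on \<open>F'\<close> implies agreement
            on the smaller set \<open>F\<close>, which is what the assumption on the outer relation
            variables asks for.\<close>
          case False
          have "map h3 us \<in> I' Y"
            by (rule Lfp.prems(7)[of C3])
              (use that F'(3) C2(3) False in \<open>auto dest: order_trans\<close>)
          then show ?thesis using False by simp
        qed
      qed
      moreover have "map h2 vs \<in> tuples (carrier N) (length xs)"
        using C2(2,4) vs(2) pos_carrier by (fastforce simp: tuples_def)
      ultimately show "map h2 vs \<in> ?L"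
        using lfp_op_unfold[OF ep, where M = N and I = I' and e = e' and X = X and xs = xs] by blast
    qed
    then show "vs \<in> S" by (simp add: S_def)
  qed
  then have "map e ys \<in> S" using Lfp.prems(8) by auto
  moreover have "\<forall>a\<in>set (map e ys). a \<in> carrier M \<and> supp a \<subseteq> C"
    using Lfp.prems(6) by auto
  ultimately have "map h (map e ys) \<in> ?L"
    using F'(4) Lfp.prems(2) unfolding S_def by blast
  moreover have "map h (map e ys) = map e' ys" using Lfp.prems(6) by auto
  ultimately show ?case unfolding sat.simps(9) by (rule back_subst[of "\<lambda>t. t \<in> ?L"])
qed simp_all

end


section \<open>A temporal CSP outside Datalog\<close>

text \<open>The relation amounts to \<open>x > min y z\<close>, which is why minimum operations
  preserve it.\<close>

definition above_one_struct :: "(rat \<Rightarrow> 'u) \<Rightarrow> (nat, 'u) struct" where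
  "above_one_struct q = \<lparr>signat = [0 \<mapsto> 3], carrier = range q,
     rel = (\<lambda>_. {[q x, q y, q z] | x y z. x > y \<or> x > z})\<rparr>"

lemma above_one_temporal:
  assumes "inj q"
  shows "temporal_struct q (above_one_struct q)"
proof -
  let ?\<phi> = "Disj (Atom () [1, 0]) (Atom () [2, 0])"
  have "{[q x, q y, q z] | x y z. x > y \<or> x > z} =
      {vs \<in> tuples (range q) 3. sat (rat_order q) (\<lambda>_. {}) (\<lambda>i. vs ! i) ?\<phi>}" (is "?L = ?R")
  proof
    show "?L \<subseteq> ?R" by (force simp: rat_order_def tuples_def)
    show "?R \<subseteq> ?L"
    proof
      fix vs assume vs: "vs \<in> ?R"
      then obtain a b c where "vs = [a, b, c]" "{a, b, c} \<subseteq> range q"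
        by (auto simp: tuples_def numeral_3_eq_3 length_Suc_conv)
      then obtain x y z where "vs = [q x, q y, q z]" by auto
      then show "vs \<in> ?L" using vs assms by (auto simp: rat_order_def inj_eq)
    qed
  qed
  then have "fo_definable (rat_order q) 3 {[q x, q y, q z] | x y z. x > y \<or> x > z}"
    unfolding fo_definable_def
    by (intro exI[of _ ?\<phi>]) (auto simp: rat_order_def)
  then show ?thesis
    by (auto simp: temporal_struct_def above_one_struct_def split: if_splits)
qed

section \<open>The torus instances and the infinite template\<close>

definition torus :: "nat \<Rightarrow> (nat, nat) struct" where
  "torus n = \<lparr>signat = [0 \<mapsto> 3], carrier = prod_encode ` ({..<n} \<times> {..<n}),
     rel = (\<lambda>_. {[prod_encode (i, j), prod_encode (Suc i mod n, j), prod_encode (i, Suc j mod n)]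
       | i j. i < n \<and> j < n})\<rparr>"

lemma torus_finite_struct: "torus n \<in> finite_structs (signat (above_one_struct q))"
  by (auto simp: finite_structs_def torus_def above_one_struct_def is_struct_def tuples_def)

text \<open>A cell of smallest value violates its own constraint, as both of its neighbours lie on
  the torus.\<close>

lemma torus_not_in_CSP:
  assumes "inj q" "n > 0"
  shows "torus n \<notin> CSP (above_one_struct q)"
proof
  assume "torus n \<in> CSP (above_one_struct q)"
  then obtain h where h: "struct_hom (torus n) (above_one_struct q) h"
    by (auto simp: CSP_def)
  define g where "g p = inv q (h (prod_encode p))" for p
  have g: "g (i, j) > g (Suc i mod n, j) \<or> g (i, j) > g (i, Suc j mod n)" if "i < n" "j < n" for i j
  proof -
    have "[prod_encode (i, j), prod_encode (Suc i mod n, j), prod_encode (i, Suc j mod n)]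
        \<in> rel (torus n) 0" "signat (torus n) 0 = Some 3"
      using that by (auto simp: torus_def)
    then have "map h [prod_encode (i, j), prod_encode (Suc i mod n, j), prod_encode (i, Suc j mod n)]
        \<in> rel (above_one_struct q) 0"
      using h unfolding struct_hom_def by blast
    then show ?thesis
      using assms(1) by (auto simp: above_one_struct_def g_def)
  qed
  have "finite ({..<n} \<times> {..<n})" "{..<n} \<times> {..<n} \<noteq> {}"
    using assms(2) by auto
  note p = arg_min_if_finite[OF this, of g]
  obtain i j where "arg_min_on g ({..<n} \<times> {..<n}) = (i, j)" by fastforce
  then have ij: "i < n" "j < n" "\<And>p. p \<in> {..<n} \<times> {..<n} \<Longrightarrow> \<not> g p < g (i, j)"
    using p by auto
  show False
    using g[OF ij(1,2)] ij(3)[of "(Suc i mod n, j)"] ij(3)[of "(i, Suc j mod n)"] ij(1,2) assms(2)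
    by auto
qed

text \<open>A copy of the template on the naturals, so that its finite substructures are instances.\<close>

definition above_one_nat :: "(nat, nat) struct" where
  "above_one_nat = \<lparr>signat = [0 \<mapsto> 3], carrier = UNIV,
     rel = (\<lambda>_. {[a, b, c] | a b c. (from_nat a :: rat) > from_nat b \<or> (from_nat a :: rat) > from_nat c})\<rparr>"

text \<open>\<open>from_nat\<close> maps the copy back to the rationals and thereby solves the
  instance.\<close>

lemma above_one_nat_substruct_in_CSP:
  assumes "finite A"
  shows "substruct above_one_nat A \<in> CSP (above_one_struct q)"
proof -
  have "struct_hom (substruct above_one_nat A) (above_one_struct q) (q \<circ> from_nat)"
    by (auto simp: struct_hom_def above_one_nat_def above_one_struct_def) blast+
  moreover have "substruct above_one_nat A \<in> finite_structs (signat (above_one_struct q))"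
    using assms
    by (auto simp: finite_structs_def above_one_nat_def above_one_struct_def is_struct_def tuples_def)
  ultimately show ?thesis by (auto simp: CSP_def)
qed

text \<open>Rows and columns share one set of pebbles, so a position with pebbled set
  \<open>C\<close> covers the cells of \<open>C \<times> C\<close>, and each cell costs at most two
  pebbles.\<close>

definition torus_supp :: "nat \<Rightarrow> nat set" where
  "torus_supp a = {fst (prod_decode a), snd (prod_decode a)}"

text \<open>The four coordinates required to lie in \<open>C\<close> form the union of the supports
  of the three cells in the constraint.\<close>

definition torus_pos :: "nat \<Rightarrow> nat set \<Rightarrow> (nat \<Rightarrow> nat) \<Rightarrow> bool" where
  "torus_pos n C h \<longleftrightarrow> (\<forall>i j. i < n \<longrightarrow> j < n \<longrightarrow> {i, j, Suc i mod n, Suc j mod n} \<subseteq> C \<longrightarrow>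
     (from_nat (h (prod_encode (i, j))) :: rat) > from_nat (h (prod_encode (Suc i mod n, j))) \<or>
     (from_nat (h (prod_encode (i, j))) :: rat) > from_nat (h (prod_encode (i, Suc j mod n))))"

text \<open>The new elements are placed below the old ones. Since some \<open>c\<close> is missing from \<open>C'\<close>, both
  coordinates can be listed linearly starting behind \<open>c\<close>, and the new elements decrease along both
  coordinates.\<close>

lemma torus_pos_extend:
  assumes "torus_pos n C h" "finite C'" "card C' < n"
  shows "\<exists>h'. torus_pos n C' h' \<and> (\<forall>a. torus_supp a \<subseteq> C \<inter> C' \<longrightarrow> h' a = h a)"
proof -
  \<comment> \<open>Pigeonhole: fewer than \<open>n\<close> pebbles leave a coordinate free, and the
    torus is cut open there.\<close>
  obtain c where c: "c < n" "c \<notin> C'"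
    using assms(2,3) by (metis card_lessThan card_mono lessThan_iff not_le subsetI)
  define r where "r a = (from_nat (h a) :: rat)" for a
  \<comment> \<open>Lists the cycle as \<open>c + 1, ..., n - 1, 0, ..., c\<close>, the part from 0
    on shifted by \<open>n\<close>. The only step that does not add one is the step from
    \<open>c\<close>.\<close>
  define l where "l i = (if i > c then i else i + n)" for i
  have l: "l (Suc i mod n) = Suc (l i)" if "i < n" "i \<in> C'" "Suc i mod n \<in> C'" for i
  proof (cases "Suc i < n")
    case True
    moreover from this have "i \<noteq> c" "Suc i \<noteq> c" using that c by auto
    ultimately show ?thesis by (auto simp: l_def)
  next
    case False
    then have "Suc i = n" using that(1) by simp
    moreover from this have "c > 0" using that c by (auto intro: gr0I)
    moreover have "i \<noteq> c" using that c by auto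
    ultimately show ?thesis using c(1) that(1) by (auto simp: l_def)
  qed
  \<comment> \<open>Subtracting 1 makes \<open>m\<close> strictly smaller than all values of
    \<open>h\<close> on the torus.\<close>
  define m where "m = Min (r ` prod_encode ` ({..<n} \<times> {..<n})) - 1"
  have m: "m < r (prod_encode (i, j))" if "i < n" "j < n" for i j
  proof -
    have "Min (r ` prod_encode ` ({..<n} \<times> {..<n})) \<le> r (prod_encode (i, j))"
      by (rule Min_le) (use that in auto)
    then show ?thesis by (simp add: m_def)
  qed
  define g where "g i j = (if i \<in> C \<and> j \<in> C then r (prod_encode (i, j)) else m - of_nat (l i + l j))" for i j
  define h' where "h' a = (if torus_supp a \<subseteq> C then h a
    else to_nat (m - of_nat (l (fst (prod_decode a)) + l (snd (prod_decode a)))))" for a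
  have h': "from_nat (h' (prod_encode (i, j))) = g i j" for i j
    by (auto simp: h'_def g_def torus_supp_def r_def)
  have low: "g i j \<le> m" if "\<not> (i \<in> C \<and> j \<in> C)" for i j
    using that by (auto simp: g_def)
  have "g i j > g (Suc i mod n) j \<or> g i j > g i (Suc j mod n)"
    if ij: "i < n" "j < n" "i \<in> C'" "j \<in> C'" "Suc i mod n \<in> C'" "Suc j mod n \<in> C'" for i j
  proof -
    consider "i \<in> C" "j \<in> C" "Suc i mod n \<in> C" "Suc j mod n \<in> C"
      | "i \<in> C" "j \<in> C" "Suc i mod n \<notin> C" | "i \<in> C" "j \<in> C" "Suc j mod n \<notin> C"
      | "i \<notin> C" | "j \<notin> C" by blast
    then show ?thesis
    proof cases
      case 1
      then show ?thesis using assms(1) ij(1,2) by (auto simp: torus_pos_def g_def r_def)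
    next
      case 2
      then have "g (Suc i mod n) j \<le> m" by (intro low) simp
      also have "m < g i j" using 2 m ij by (simp add: g_def)
      finally show ?thesis by simp
    next
      case 3
      then have "g i (Suc j mod n) \<le> m" by (intro low) simp
      also have "m < g i j" using 3 m ij by (simp add: g_def)
      finally show ?thesis by simp
    next
      \<comment> \<open>As \<open>i\<close> is not in \<open>C\<close>, both \<open>(i, j)\<close>
        and its neighbour in the second coordinate are new, and the value drops by one between
        them.\<close>
      case 4
      then show ?thesis using l[OF ij(2,4,6)] by (simp add: g_def)
    next
      case 5
      then show ?thesis using l[OF ij(1,3,5)] by (simp add: g_def)
    qed
  qed
  then have "torus_pos n C' h'" by (auto simp: torus_pos_def h')
  moreover have "\<forall>a. torus_supp a \<subseteq> C \<inter> C' \<longrightarrow> h' a = h a" by (auto simp: h'_def)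
  ultimately show ?thesis by blast
qed

lemma pebble_strategy_torus:
  assumes "k < n"
  shows "pebble_strategy (torus n) above_one_nat torus_supp 2 k (torus_pos n)"
proof
  show "finite (torus_supp a)" "card (torus_supp a) \<le> 2" for a
    by (auto simp: torus_supp_def card_insert_if)
  show "h a \<in> carrier above_one_nat" for h a by (simp add: above_one_nat_def)
  show "map h t \<in> rel above_one_nat R"
    if "torus_pos n C h" "t \<in> rel (torus n) R" "(\<Union>a\<in>set t. torus_supp a) \<subseteq> C" for C h t R
    using that by (auto simp: torus_def torus_pos_def above_one_nat_def torus_supp_def)
  show "\<exists>h'. torus_pos n C' h' \<and> (\<forall>a. torus_supp a \<subseteq> C \<inter> C' \<longrightarrow> h' a = h a)"
    if "torus_pos n C h" "finite C'" "card C' \<le> k" for C h C'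
    using torus_pos_extend[OF that(1,2)] that(3) assms by simp
qed

lemma above_one_not_in_Datalog:
  assumes "inj q"
  shows "\<not> CSP_in_Datalog (above_one_struct q)"
proof
  assume "CSP_in_Datalog (above_one_struct q)"
  then obtain \<phi> where \<phi>: "datalog_sentence (signat (above_one_struct q)) \<phi>"
    "\<And>M. M \<in> finite_structs (signat (above_one_struct q)) \<Longrightarrow> models M \<phi> \<longleftrightarrow> M \<notin> CSP (above_one_struct q)"
    unfolding CSP_in_Datalog_def by blast
  have ep: "existential_positive \<phi>" and closed: "free_vars \<phi> = {}"
    using \<phi>(1) by (auto simp: datalog_sentence_def)
  \<comment> \<open>Two pebbles per variable value; a torus with \<open>Suc k\<close> coordinates
    then always leaves one of them free.\<close>
  define k where "k = 2 * pebble_cost \<phi>"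
  interpret pebble_strategy "torus (Suc k)" above_one_nat torus_supp 2 k "torus_pos (Suc k)"
    by (rule pebble_strategy_torus) simp
  have "models (torus (Suc k)) \<phi>"
    using \<phi>(2)[OF torus_finite_struct] torus_not_in_CSP[OF assms] by simp
  then have "sat (torus (Suc k)) (\<lambda>_. {}) (\<lambda>_. undefined) \<phi>" by (simp add: models_def)
  then have "sat above_one_nat (\<lambda>_. {}) (\<lambda>_. undefined) \<phi>"
    \<comment> \<open>The game starts without pebbles: \<open>torus_pos\<close> holds vacuously for
      the empty set, and \<open>id\<close> is an arbitrary choice.\<close>
    by (rule sat_transfer[OF ep, of "{}" id "{}", rotated -1])
      (use closed in \<open>auto simp: torus_pos_def k_def\<close>)
  \<comment> \<open>The sentence is known to be correct on finite structures only, so the infinite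
    template is replaced by a finite part.\<close>
  then have "\<exists>A. finite A \<and> A \<subseteq> carrier above_one_nat \<and>
      sat (substruct above_one_nat A) (\<lambda>_. {}) (\<lambda>_. undefined) \<phi>"
    by (intro sat_finite_substruct[OF ep]) (auto simp: above_one_nat_def)
  then obtain A where A: "finite A" "models (substruct above_one_nat A) \<phi>"
    by (auto simp: models_def)
  have "substruct above_one_nat A \<in> CSP (above_one_struct q)"
    using A(1) by (rule above_one_nat_substruct_in_CSP)
  moreover from this have "substruct above_one_nat A \<in> finite_structs (signat (above_one_struct q))"
    by (simp add: CSP_def)
  ultimately show False using \<phi>(2) A(2) by blast
qed


section \<open>A temporal CSP in Datalog\<close>

text \<open>Both relations are definable from equality alone, so a solution is determined up to an
  injective renaming of its values by its kernel.\<close>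

definition eq_horn_struct :: "(rat \<Rightarrow> 'u) \<Rightarrow> (nat, 'u) struct" where
  "eq_horn_struct q = \<lparr>signat = [0 \<mapsto> 2, 1 \<mapsto> 4], carrier = range q,
     rel = (\<lambda>R. if R = 0 then {[a, b] | a b. {a, b} \<subseteq> range q \<and> a \<noteq> b}
       else {[a, b, c, d] | a b c d. {a, b, c, d} \<subseteq> range q \<and> (a = b \<longrightarrow> c = d)})\<rparr>"

lemma eq_horn_simps [simp]:
  "signat (eq_horn_struct q) = [0 \<mapsto> 2, 1 \<mapsto> 4]"
  "carrier (eq_horn_struct q) = range q"
  "vs \<in> rel (eq_horn_struct q) 0 \<longleftrightarrow> (\<exists>a b. vs = [a, b] \<and> {a, b} \<subseteq> range q \<and> a \<noteq> b)"
  "vs \<in> rel (eq_horn_struct q) (Suc 0) \<longleftrightarrow>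
     (\<exists>a b c d. vs = [a, b, c, d] \<and> {a, b, c, d} \<subseteq> range q \<and> (a = b \<longrightarrow> c = d))"
  by (auto simp: eq_horn_struct_def)

lemma eq_horn_temporal: "temporal_struct q (eq_horn_struct q)"
proof -
  have "fo_definable (rat_order q) 2 (rel (eq_horn_struct q) 0)"
    unfolding fo_definable_def
    by (rule exI[of _ "Neg (Eq 0 1)"])
      (auto simp: rat_order_def tuples_def numeral_2_eq_2 length_Suc_conv)
  moreover have "fo_definable (rat_order q) 4 (rel (eq_horn_struct q) (Suc 0))"
    unfolding fo_definable_def
    by (rule exI[of _ "Disj (Neg (Eq 0 1)) (Eq 2 3)"])
      (auto simp: rat_order_def tuples_def eval_nat_numeral length_Suc_conv)
  ultimately show ?thesis
    by (auto simp: temporal_struct_def split: if_splits)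
qed

text \<open>The rules for the least equivalence relation closed under the implications: reflexivity,
  symmetry, transitivity, and the conclusion of an implication whose premise has been derived.
  Variables 0 and 1 hold the derived pair.\<close>

definition eq_closure_formula :: "nat formula" where
  "eq_closure_formula = Disj (Eq 0 1) (Disj (RelVar 0 [1, 0])
     (Disj (Ex 2 (Conj (RelVar 0 [0, 2]) (RelVar 0 [2, 1])))
       (Ex 2 (Ex 3 (Conj (RelVar 0 [2, 3]) (Atom 1 [2, 3, 0, 1]))))))"

definition eq_horn_datalog :: "nat formula" where
  "eq_horn_datalog =
     Ex 0 (Ex 1 (Conj (Atom 0 [0, 1]) (Lfp 0 [0, 1] eq_closure_formula [0, 1])))"

lemma datalog_sentence_eq_horn: "datalog_sentence (signat (eq_horn_struct q)) eq_horn_datalog"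
  by (auto simp: datalog_sentence_def eq_horn_datalog_def eq_closure_formula_def)

lemma sat_eq_closure_formula:
  "sat M (I(0 := S)) (upd_list e [0, 1] [a, b]) eq_closure_formula \<longleftrightarrow>
     a = b \<or> [b, a] \<in> S \<or> (\<exists>c\<in>carrier M. [a, c] \<in> S \<and> [c, b] \<in> S) \<or>
     (\<exists>c\<in>carrier M. \<exists>d\<in>carrier M. [c, d] \<in> S \<and> [c, d, a, b] \<in> rel M 1)"
  by (simp add: eq_closure_formula_def upd_list_def)

definition eq_closure_op :: "(nat, 'a) struct \<Rightarrow> 'a list set \<Rightarrow> 'a list set" where
  "eq_closure_op M S = {[a, b] | a b. a \<in> carrier M \<and> b \<in> carrier M \<and>
     (a = b \<or> [b, a] \<in> S \<or> (\<exists>c\<in>carrier M. [a, c] \<in> S \<and> [c, b] \<in> S) \<or>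
      (\<exists>c\<in>carrier M. \<exists>d\<in>carrier M. [c, d] \<in> S \<and> [c, d, a, b] \<in> rel M 1))}"

lemma models_eq_horn_datalog:
  "models M eq_horn_datalog \<longleftrightarrow>
     (\<exists>a\<in>carrier M. \<exists>b\<in>carrier M. [a, b] \<in> rel M 0 \<and> [a, b] \<in> lfp (eq_closure_op M))"
proof -
  have "{vs \<in> tuples (carrier M) (length [0 :: nat, 1]).
      sat M (I(0 := S)) (upd_list e [0, 1] vs) eq_closure_formula} = eq_closure_op M S" for I e S
  proof -
    have "tuples (carrier M) (length [0 :: nat, 1]) = {[a, b] | a b. a \<in> carrier M \<and> b \<in> carrier M}"
      by (auto simp: tuples_def length_Suc_conv)
    then show ?thesis
      unfolding eq_closure_op_def by (auto simp: sat_eq_closure_formula simp del: One_nat_def length_Cons)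
  qed
  then show ?thesis
    by (simp add: models_def eq_horn_datalog_def del: length_Cons One_nat_def)
qed

text \<open>The kernel of every solution contains the closure \<open>E\<close>. Conversely,
  \<open>E\<close> is an equivalence relation closed under the implications, so giving distinct
  values to distinct classes is a solution unless \<open>E\<close> contains a pair required to be
  unequal.\<close>

lemma eq_horn_in_Datalog:
  fixes q :: "rat \<Rightarrow> 'u"
  assumes "inj q"
  shows "CSP_in_Datalog (eq_horn_struct q)"
  unfolding CSP_in_Datalog_def
proof (intro exI[of _ eq_horn_datalog] conjI datalog_sentence_eq_horn ballI)
  fix M :: "(nat, nat) struct"
  assume M: "M \<in> finite_structs (signat (eq_horn_struct q))"
  then have sig: "signat M = [0 \<mapsto> 2, 1 \<mapsto> 4]" and "is_struct M"
    by (auto simp: finite_structs_def)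
  then have rel0: "rel M 0 \<subseteq> tuples (carrier M) 2" and rel1: "rel M 1 \<subseteq> tuples (carrier M) 4"
    by (auto simp: is_struct_def)
  define E where "E = lfp (eq_closure_op M)"
  have "mono (eq_closure_op M)"
    unfolding eq_closure_op_def by (rule monoI) blast
  then have E: "E = eq_closure_op M E"
    unfolding E_def by (rule lfp_unfold)
  have "M \<in> CSP (eq_horn_struct q) \<longleftrightarrow>
      \<not> (\<exists>a\<in>carrier M. \<exists>b\<in>carrier M. [a, b] \<in> rel M 0 \<and> [a, b] \<in> E)" (is "?L \<longleftrightarrow> \<not> ?R")
  proof
    assume ?L
    then obtain h where h: "struct_hom M (eq_horn_struct q) h" by (auto simp: CSP_def)
    have h0: "h a \<noteq> h b" if "[a, b] \<in> rel M 0" for a b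
    proof -
      have "map h [a, b] \<in> rel (eq_horn_struct q) 0"
        using h that sig unfolding struct_hom_def by (metis fun_upd_apply zero_neq_one)
      then show ?thesis by simp
    qed
    have h1: "h c = h d" if "[a, b, c, d] \<in> rel M (Suc 0)" "h a = h b" for a b c d
    proof -
      have "map h [a, b, c, d] \<in> rel (eq_horn_struct q) 1"
        using h that(1) sig unfolding struct_hom_def One_nat_def by (metis fun_upd_apply)
      then show ?thesis using that(2) by simp
    qed
    \<comment> \<open>The kernel of \<open>h\<close> is closed under all rules; \<open>h1\<close>
      takes care of the implications.\<close>
    have "E \<subseteq> {[a, b] | a b. h a = h b}"
      unfolding E_def by (rule lfp_lowerbound) (auto simp: eq_closure_op_def dest: h1)
    then show "\<not> ?R" using h0 by auto
  next
    assume R: "\<not> ?R"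
    have E_carrier: "a \<in> carrier M" "b \<in> carrier M" if "[a, b] \<in> E" for a b
      using subsetD[OF equalityD1[OF E] that] by (auto simp: eq_closure_op_def)
    have E_refl: "[a, a] \<in> E" if "a \<in> carrier M" for a
      by (subst E) (use that in \<open>auto simp: eq_closure_op_def\<close>)
    have E_sym: "[b, a] \<in> E" if "[a, b] \<in> E" for a b
      by (subst E) (use that E_carrier[OF that] in \<open>auto simp: eq_closure_op_def\<close>)
    have E_trans: "[a, c] \<in> E" if "[a, b] \<in> E" "[b, c] \<in> E" for a b c
      by (subst E) (use that E_carrier[OF that(1)] E_carrier[OF that(2)] in \<open>auto simp: eq_closure_op_def\<close>)
    have E_horn: "[c, d] \<in> E" if "[a, b, c, d] \<in> rel M 1" "[a, b] \<in> E" for a b c d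
    proof -
      have "{a, b, c, d} \<subseteq> carrier M" using that(1) rel1 by (auto simp: tuples_def)
      then show ?thesis
        by (subst E) (use that in \<open>auto simp: eq_closure_op_def\<close>)
    qed
    \<comment> \<open>Elements of instances are naturals, so the smallest member of a class can
      represent it.\<close>
    define f where "f a = (LEAST b. [a, b] \<in> E)" for a
    have f_E: "[a, f a] \<in> E" if "a \<in> carrier M" for a
      unfolding f_def using E_refl[OF that] by (rule LeastI)
    have f: "f a = f b \<longleftrightarrow> [a, b] \<in> E" if "a \<in> carrier M" "b \<in> carrier M" for a b
    proof
      assume "f a = f b"
      then show "[a, b] \<in> E" using f_E that E_sym E_trans by metis
    next
      assume "[a, b] \<in> E"
      then have "[a, c] \<in> E \<longleftrightarrow> [b, c] \<in> E" for c using E_sym E_trans by metis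
      then show "f a = f b" by (simp add: f_def)
    qed
    define h where "h a = q (of_nat (f a))" for a
    have h: "h a = h b \<longleftrightarrow> [a, b] \<in> E" if "a \<in> carrier M" "b \<in> carrier M" for a b
      using f[OF that] assms by (simp add: h_def inj_eq)
    have "map h t \<in> rel (eq_horn_struct q) 0" if t: "t \<in> rel M 0" for t
    proof -
      obtain a b where "t = [a, b]" "a \<in> carrier M" "b \<in> carrier M"
        using t rel0 by (auto simp: tuples_def numeral_2_eq_2 length_Suc_conv subset_iff)
      then show ?thesis using R t h by (auto simp: h_def)
    qed
    moreover have "map h t \<in> rel (eq_horn_struct q) (Suc 0)" if t: "t \<in> rel M 1" for t
    proof -
      have "length t = 4" "set t \<subseteq> carrier M" using t rel1 by (auto simp: tuples_def)
      then obtain a b c d where t_eq: "t = [a, b, c, d]" and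
        "a \<in> carrier M" "b \<in> carrier M" "c \<in> carrier M" "d \<in> carrier M"
        by (auto simp: eval_nat_numeral length_Suc_conv)
      then have "h a = h b \<longrightarrow> h c = h d" using h E_horn t by auto
      then show ?thesis by (auto simp: t_eq h_def)
    qed
    ultimately have "struct_hom M (eq_horn_struct q) h"
      using sig by (auto simp: struct_hom_def h_def)
    then show ?L using M by (auto simp: CSP_def)
  qed
  then show "models M eq_horn_datalog \<longleftrightarrow> M \<notin> CSP (eq_horn_struct q)"
    unfolding models_eq_horn_datalog E_def by blast
qed


section \<open>Essential arguments\<close>

text \<open>The arguments that can be recovered from the value of \<open>f\<close>. An arbitrary
  \<open>f\<close> may depend on further arguments; \<open>kernel_on_ess_args\<close> excludes this
  for the polymorphisms at hand.\<close>

definition ess_args :: "'a set \<Rightarrow> nat \<Rightarrow> ('a list \<Rightarrow> 'b) \<Rightarrow> nat set" where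
  "ess_args A n f = {i. i < n \<and> (\<forall>xs\<in>tuples A n. \<forall>ys\<in>tuples A n. f xs = f ys \<longrightarrow> xs ! i = ys ! i)}"

lemma ess_args_subset: "ess_args A n f \<subseteq> {..<n}"
  by (auto simp: ess_args_def)

definition kernel_on :: "'a set \<Rightarrow> nat \<Rightarrow> ('a list \<Rightarrow> 'b) \<Rightarrow> nat set \<Rightarrow> bool" where
  "kernel_on A n f S \<longleftrightarrow> S \<subseteq> {..<n} \<and>
     (\<forall>xs\<in>tuples A n. \<forall>ys\<in>tuples A n. f xs = f ys \<longleftrightarrow> (\<forall>i\<in>S. xs ! i = ys ! i))"

lemma replicate_in_tuples: "a \<in> A \<Longrightarrow> replicate n a \<in> tuples A n"
  by (auto simp: tuples_def)

lemma list_update_in_tuples: "xs \<in> tuples A n \<Longrightarrow> b \<in> A \<Longrightarrow> xs[i := b] \<in> tuples A n"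
  using set_update_subset_insert[of xs i b] by (auto simp: tuples_def)

text \<open>The two tuples differ in entry \<open>i\<close> alone, so \<open>S\<close> can be read
  off from values on tuples over two elements. Uniqueness of \<open>S\<close> and uniform continuity
  rest on this test.\<close>

lemma kernel_on_replicate:
  assumes "kernel_on A n f S" "a \<in> A" "b \<in> A" "a \<noteq> b" "i < n"
  shows "i \<in> S \<longleftrightarrow> f (replicate n a) \<noteq> f ((replicate n a)[i := b])"
proof -
  have "f (replicate n a) = f ((replicate n a)[i := b]) \<longleftrightarrow>
      (\<forall>j\<in>S. replicate n a ! j = (replicate n a)[i := b] ! j)"
    using assms(1) replicate_in_tuples[OF assms(2), of n]
      list_update_in_tuples[OF replicate_in_tuples[OF assms(2)] assms(3), of n i]
    unfolding kernel_on_def by blast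
  also have "\<dots> \<longleftrightarrow> i \<notin> S"
    using assms by (auto simp: kernel_on_def nth_list_update)
  finally show ?thesis by blast
qed

lemma kernel_on_unique:
  assumes "kernel_on A n f S" "kernel_on A n f T" "a \<in> A" "b \<in> A" "a \<noteq> b"
  shows "S = T"
proof -
  have "S \<subseteq> {..<n}" "T \<subseteq> {..<n}" using assms(1,2) by (auto simp: kernel_on_def)
  then show ?thesis
    using kernel_on_replicate[OF assms(1,3-5)] kernel_on_replicate[OF assms(2-5)] by blast
qed

text \<open>Turn \<open>xs\<close> into \<open>ys\<close> one entry at a time, from the left. An
  entry changes only where the two differ, and there the last assumption applies.\<close>

lemma kernel_on_eqI:
  assumes "xs \<in> tuples A n" "ys \<in> tuples A n"
    and "\<And>us i w. us \<in> tuples A n \<Longrightarrow> w \<in> A \<Longrightarrow> i < n \<Longrightarrow> xs ! i \<noteq> ys ! i \<Longrightarrow> f us = f (us[i := w])"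
  shows "f xs = f ys"
proof -
  have len: "length xs = n" "length ys = n" "set xs \<subseteq> A" "set ys \<subseteq> A"
    using assms by (auto simp: tuples_def)
  have "f (take j ys @ drop j xs) = f xs" if "j \<le> n" for j
    using that
  proof (induction j)
    case (Suc j)
    let ?us = "take j ys @ drop j xs"
    have us: "?us \<in> tuples A n"
      using len Suc.prems set_take_subset[of j ys] set_drop_subset[of j xs]
      by (auto simp: tuples_def)
    have step: "take (Suc j) ys @ drop (Suc j) xs = ?us[j := ys ! j]"
      using len Suc.prems
      by (simp add: list_update_append take_Suc_conv_app_nth Cons_nth_drop_Suc[symmetric])
    have nth: "?us ! j = xs ! j" using len Suc.prems by (simp add: nth_append)
    have "f (?us[j := ys ! j]) = f ?us"
    proof (cases "xs ! j = ys ! j")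
      case True
      then show ?thesis by (metis nth list_update_id)
    next
      case False
      then show ?thesis
        using assms(3)[OF us, of "ys ! j" j] len Suc.prems by (auto simp: subset_iff)
    qed
    then show ?case using Suc step by simp
  qed simp
  from this[of n] show ?thesis using len by simp
qed

text \<open>The definition of \<open>polymorphism\<close> transposed: the argument lists of
  \<open>f\<close> are the rows \<open>xss\<close>, and the tuples of the relation are the
  columns.\<close>

lemma polymorphism_apply:
  assumes "polymorphism B n f" "signat B R = Some k"
    and "\<And>i. i < n \<Longrightarrow> map (\<lambda>xs. xs ! i) xss \<in> rel B R" "length xss = k"
    and "\<And>xs. xs \<in> set xss \<Longrightarrow> length xs = n"
  shows "map f xss \<in> rel B R"
proof -
  define ts where "ts = map (\<lambda>i. map (\<lambda>xs. xs ! i) xss) [0..<n]"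
  have "length ts = n" "set ts \<subseteq> rel B R" using assms(3) by (auto simp: ts_def)
  then have "map (\<lambda>j. f (map (\<lambda>t. t ! j) ts)) [0..<k] \<in> rel B R"
    using assms(1,2) unfolding polymorphism_def by blast
  moreover have "map (\<lambda>j. f (map (\<lambda>t. t ! j) ts)) [0..<k] = map f xss"
  proof (rule nth_equalityI)
    fix j assume "j < length (map (\<lambda>j. f (map (\<lambda>t. t ! j) ts)) [0..<k])"
    then have j: "j < k" by simp
    then have "map (\<lambda>t. t ! j) ts = xss ! j"
      using assms(4,5) by (intro nth_equalityI) (auto simp: ts_def)
    then show "map (\<lambda>j. f (map (\<lambda>t. t ! j) ts)) [0..<k] ! j = map f xss ! j"
      using j assms(4) by simp
  qed (use assms(4) in simp)
  ultimately show ?thesis by simp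
qed

text \<open>If \<open>i\<close> is not essential, some \<open>vs\<close> and \<open>zs\<close> have
  equal values but differ in entry \<open>i\<close>. Then \<open>vs\<close>, \<open>zs\<close>,
  \<open>us\<close>, \<open>us[i := w]\<close> satisfy the implication in every coordinate: its
  premise fails at \<open>i\<close>, and its conclusion holds elsewhere. As \<open>f\<close>
  preserves it, changing entry \<open>i\<close> never changes the value.\<close>

lemma kernel_on_ess_args:
  assumes "polymorphism (eq_horn_struct q) n f"
  shows "kernel_on (range q) n f (ess_args (range q) n f)"
proof -
  have "f xs = f ys" if xy: "xs \<in> tuples (range q) n" "ys \<in> tuples (range q) n"
    "\<forall>i\<in>ess_args (range q) n f. xs ! i = ys ! i" for xs ys
  proof (rule kernel_on_eqI[OF xy(1,2)])
    fix us i w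
    assume us: "us \<in> tuples (range q) n" "w \<in> range q" "i < n" "xs ! i \<noteq> ys ! i"
    then obtain vs zs where vz: "vs \<in> tuples (range q) n" "zs \<in> tuples (range q) n" "f vs = f zs"
      "vs ! i \<noteq> zs ! i"
      using xy(3) unfolding ess_args_def by blast
    have uw: "us[i := w] \<in> tuples (range q) n"
      using us by (intro list_update_in_tuples) auto
    have "map f [vs, zs, us, us[i := w]] \<in> rel (eq_horn_struct q) (Suc 0)"
    proof (rule polymorphism_apply[OF assms])
      show "map (\<lambda>xs. xs ! j) [vs, zs, us, us[i := w]] \<in> rel (eq_horn_struct q) (Suc 0)"
        if "j < n" for j
        using that us uw vz by (cases "j = i") (auto simp: tuples_def subset_iff)
    qed (use us uw vz in \<open>auto simp: tuples_def\<close>)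
    then show "f us = f (us[i := w])" using vz(3) by simp
  qed
  moreover have "xs ! i = ys ! i" if "i \<in> ess_args (range q) n f" "xs \<in> tuples (range q) n"
    "ys \<in> tuples (range q) n" "f xs = f ys" for xs ys i
    using that unfolding ess_args_def by blast
  ultimately show ?thesis using ess_args_subset[of "range q" n f] unfolding kernel_on_def by blast
qed

text \<open>Otherwise \<open>f\<close> would be constant, but preserving disequality forces
  different values on two constant tuples.\<close>

lemma ess_args_nonempty:
  assumes "polymorphism (eq_horn_struct q) n f" "inj q"
  shows "ess_args (range q) n f \<noteq> {}"
proof
  assume empty: "ess_args (range q) n f = {}"
  have "replicate n (q c) \<in> tuples (range q) n" for c
    by (intro replicate_in_tuples) simp
  then have "f (replicate n (q 0)) = f (replicate n (q 1))"
    using kernel_on_ess_args[OF assms(1)] unfolding kernel_on_def empty by blast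
  moreover have "map f [replicate n (q 0), replicate n (q 1)] \<in> rel (eq_horn_struct q) 0"
    by (rule polymorphism_apply[OF assms(1)]) (use assms(2) in \<open>auto simp: inj_eq\<close>)
  ultimately show False by simp
qed

lemma finite_ess_args: "finite (ess_args A n f)"
  by (simp add: ess_args_def)


section \<open>The clone homomorphism\<close>

lemma above_one_simps [simp]:
  "signat (above_one_struct q) = [0 \<mapsto> 3]"
  "carrier (above_one_struct q) = range q"
  "rel (above_one_struct q) R = {[q x, q y, q z] | x y z. x > y \<or> x > z}"
  by (auto simp: above_one_struct_def)

definition min_on :: "(rat \<Rightarrow> 'u) \<Rightarrow> nat \<Rightarrow> nat set \<Rightarrow> 'u list \<Rightarrow> 'u" where
  "min_on q n S = restrict (\<lambda>xs. q (Min ((\<lambda>i. inv q (xs ! i)) ` S))) (tuples (range q) n)"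

lemma min_on_apply:
  "xs \<in> tuples (range q) n \<Longrightarrow> min_on q n S xs = q (Min ((\<lambda>i. inv q (xs ! i)) ` S))"
  by (simp add: min_on_def)

text \<open>Let \<open>i\<close> in \<open>S\<close> attain the minimum of the first coordinates.
  The tuple at \<open>i\<close> has a later coordinate below its first one, and that coordinate
  bounds the corresponding minimum from above.\<close>

lemma polymorphism_min_on:
  assumes "inj q" "S \<subseteq> {..<n}" "S \<noteq> {}"
  shows "polymorphism (above_one_struct q) n (min_on q n S)"
  unfolding polymorphism_def
proof (intro conjI allI impI)
  have fin: "finite S" using assms(2) finite_subset by blast
  show "1 \<le> n" using assms(2,3) by auto
  show "min_on q n S \<in> tuples (carrier (above_one_struct q)) n \<rightarrow>\<^sub>E carrier (above_one_struct q)"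
    by (auto simp: min_on_def)
  fix R :: nat and k ts
  assume *: "signat (above_one_struct q) R = Some k \<and> length ts = n \<and> set ts \<subseteq> rel (above_one_struct q) R"
  then have k: "k = 3" by (auto split: if_splits)
  define m where "m j = Min ((\<lambda>i. inv q (ts ! i ! j)) ` S)" for j
  have ts: "\<exists>x y z. ts ! i = [q x, q y, q z] \<and> (x > y \<or> x > z)" if "i < n" for i
    using * nth_mem[of i ts] that by fastforce
  have row: "min_on q n S (map (\<lambda>t. t ! j) ts) = q (m j)" if "j < 3" for j
  proof -
    have "map (\<lambda>t. t ! j) ts \<in> tuples (range q) n"
      using * that by (fastforce simp: tuples_def less_Suc_eq numeral_3_eq_3)
    moreover have "(\<lambda>i. inv q (map (\<lambda>t. t ! j) ts ! i)) ` S = (\<lambda>i. inv q (ts ! i ! j)) ` S"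
      using * assms(2) by (intro image_cong) auto
    ultimately show ?thesis by (simp add: min_on_apply m_def)
  qed
  have "m 0 \<in> (\<lambda>i. inv q (ts ! i ! 0)) ` S"
    unfolding m_def using fin assms(3) by (intro Min_in) auto
  then obtain i where i: "i \<in> S" "m 0 = inv q (ts ! i ! 0)" by auto
  then obtain x y z where xyz: "ts ! i = [q x, q y, q z]" "x > y \<or> x > z"
    using ts assms(2) by blast
  have le: "m j \<le> inv q (ts ! i ! j)" for j
    unfolding m_def using fin i(1) by (intro Min_le) auto
  have "m 0 > m 1 \<or> m 0 > m 2"
    using i(2) xyz le[of 1] le[of 2] assms(1) by auto
  moreover have "map (\<lambda>j. min_on q n S (map (\<lambda>t. t ! j) ts)) [0..<k] = [q (m 0), q (m 1), q (m 2)]"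
    using row[of 0] row[of 1] row[of 2] by (simp add: k upt_rec numeral_2_eq_2)
  ultimately show "map (\<lambda>j. min_on q n S (map (\<lambda>t. t ! j) ts)) [0..<k] \<in> rel (above_one_struct q) R"
    by auto
qed

section \<open>From essential arguments to minimum operations\<close>

definition min_ess :: "(rat \<Rightarrow> 'u) \<Rightarrow> nat \<Rightarrow> ('u list \<Rightarrow> 'u) \<Rightarrow> 'u list \<Rightarrow> 'u" where
  "min_ess q n f = min_on q n (ess_args (range q) n f)"

text \<open>Any set that describes the kernel is unique, because \<open>q 0\<close> and
  \<open>q 1\<close> are distinct. This reduces the computation of essential arguments to checking a
  candidate.\<close>

lemma ess_args_eqI:
  fixes q :: "rat \<Rightarrow> 'u"
  assumes "inj q" "kernel_on (range q) n f S"
  shows "ess_args (range q) n f = S"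
proof -
  have "kernel_on (range q) n f (ess_args (range q) n f)"
    using assms(2) unfolding kernel_on_def ess_args_def by blast
  moreover have "q 0 \<noteq> q 1" using assms(1) by (simp add: inj_eq)
  ultimately show ?thesis
    using kernel_on_unique[OF _ assms(2)] by blast
qed

lemma ess_args_proj:
  fixes q :: "rat \<Rightarrow> 'u"
  assumes "inj q" "i < n"
  shows "ess_args (range q) n (proj (range q) n i) = {i}"
  by (rule ess_args_eqI[OF assms(1)]) (use assms(2) in \<open>auto simp: kernel_on_def proj_def\<close>)

text \<open>Two values of the composition agree iff the inner operations at the essential positions
  of \<open>f\<close> agree, which in turn means agreement on the essential arguments of each of
  them.\<close>

lemma ess_args_compose:
  fixes q :: "rat \<Rightarrow> 'u"
  assumes "inj q" "polymorphism (eq_horn_struct q) n f"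
    and "length gs = n" "\<And>g. g \<in> set gs \<Longrightarrow> polymorphism (eq_horn_struct q) m g"
  shows "ess_args (range q) m (compose_ops (range q) m f gs) =
    (\<Union>i\<in>ess_args (range q) n f. ess_args (range q) m (gs ! i))"
proof (rule ess_args_eqI[OF assms(1)])
  let ?A = "range q" and ?S = "ess_args (range q) n f"
  have inner: "map (\<lambda>g. g xs) gs \<in> tuples ?A n" if "xs \<in> tuples ?A m" for xs
  proof -
    have "g xs \<in> ?A" if "g \<in> set gs" for g
      using assms(4)[OF that] \<open>xs \<in> tuples ?A m\<close> PiE_mem
      unfolding polymorphism_def eq_horn_simps(2) by blast
    then show ?thesis using assms(3) by (auto simp: tuples_def)
  qed
  have S: "?S \<subseteq> {..<n}" by (rule ess_args_subset)
  have "compose_ops ?A m f gs xs = compose_ops ?A m f gs ys \<longleftrightarrow>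
      (\<forall>j\<in>(\<Union>i\<in>?S. ess_args ?A m (gs ! i)). xs ! j = ys ! j)"
    if xy: "xs \<in> tuples ?A m" "ys \<in> tuples ?A m" for xs ys
  proof -
    have "compose_ops ?A m f gs xs = compose_ops ?A m f gs ys \<longleftrightarrow>
        f (map (\<lambda>g. g xs) gs) = f (map (\<lambda>g. g ys) gs)"
      using xy by (simp add: compose_ops_def)
    also have "\<dots> \<longleftrightarrow> (\<forall>i\<in>?S. map (\<lambda>g. g xs) gs ! i = map (\<lambda>g. g ys) gs ! i)"
      using kernel_on_ess_args[OF assms(2)] inner xy unfolding kernel_on_def by blast
    also have "\<dots> \<longleftrightarrow> (\<forall>i\<in>?S. (gs ! i) xs = (gs ! i) ys)"
      using S assms(3) by (intro ball_cong) auto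
    also have "\<dots> \<longleftrightarrow> (\<forall>i\<in>?S. \<forall>j\<in>ess_args ?A m (gs ! i). xs ! j = ys ! j)"
    proof (rule ball_cong[OF refl])
      fix i assume "i \<in> ?S"
      then have "polymorphism (eq_horn_struct q) m (gs ! i)"
        using S assms(3,4) by auto
      from kernel_on_ess_args[OF this] xy
      show "(gs ! i) xs = (gs ! i) ys \<longleftrightarrow> (\<forall>j\<in>ess_args ?A m (gs ! i). xs ! j = ys ! j)"
        unfolding kernel_on_def by blast
    qed
    finally show ?thesis by blast
  qed
  moreover have "(\<Union>i\<in>?S. ess_args ?A m (gs ! i)) \<subseteq> {..<m}"
    using ess_args_subset by blast
  ultimately show "kernel_on ?A m (compose_ops ?A m f gs) (\<Union>i\<in>?S. ess_args ?A m (gs ! i))"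
    unfolding kernel_on_def by blast
qed

text \<open>A minimum over a union is the minimum of the minima. This is the counterpart of
  \<open>ess_args_compose\<close> on the side of the target clone; nonemptiness makes every
  \<open>Min\<close> meaningful.\<close>

lemma min_on_UN:
  assumes "inj q" "S \<subseteq> {..<n}" "S \<noteq> {}"
    and "\<And>i. i \<in> S \<Longrightarrow> finite (T i) \<and> T i \<noteq> {}"
    and "length hs = n" "\<And>i. i \<in> S \<Longrightarrow> hs ! i = min_on q m (T i)"
    and "\<And>h. h \<in> set hs \<Longrightarrow> h \<in> tuples (range q) m \<rightarrow> range q"
  shows "min_on q m (\<Union>i\<in>S. T i) = compose_ops (range q) m (min_on q n S) hs"
proof (rule ext)
  fix xs
  have fin: "finite S" using assms(2) finite_subset by blast
  show "min_on q m (\<Union>i\<in>S. T i) xs = compose_ops (range q) m (min_on q n S) hs xs"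
  proof (cases "xs \<in> tuples (range q) m")
    case True
    define r where "r j = inv q (xs ! j)" for j
    have "map (\<lambda>h. h xs) hs \<in> tuples (range q) n"
      using assms(5,7) True by (fastforce simp: tuples_def)
    then have "compose_ops (range q) m (min_on q n S) hs xs =
        q (Min ((\<lambda>i. inv q (map (\<lambda>h. h xs) hs ! i)) ` S))"
      using True by (simp add: compose_ops_def min_on_apply)
    also have "(\<lambda>i. inv q (map (\<lambda>h. h xs) hs ! i)) ` S = (\<lambda>i. Min (r ` T i)) ` S"
    proof (rule image_cong[OF refl])
      fix i assume "i \<in> S"
      then have "map (\<lambda>h. h xs) hs ! i = q (Min (r ` T i))"
        using assms(2,5,6) True by (auto simp: min_on_apply r_def)
      then show "inv q (map (\<lambda>h. h xs) hs ! i) = Min (r ` T i)"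
        using assms(1) by simp
    qed
    also have "Min ((\<lambda>i. Min (r ` T i)) ` S) = Min (r ` (\<Union>i\<in>S. T i))"
    proof (rule antisym)
      have *: "finite (r ` (\<Union>i\<in>S. T i))" "r ` (\<Union>i\<in>S. T i) \<noteq> {}"
        using fin assms(3,4) by auto
      show "Min ((\<lambda>i. Min (r ` T i)) ` S) \<le> Min (r ` (\<Union>i\<in>S. T i))"
        using Min_in[OF *] fin assms(4) by (auto intro: Min_le order_trans[OF Min_le[OF _ imageI]])
      have "Min (r ` (\<Union>i\<in>S. T i)) \<le> Min (r ` T i)" if "i \<in> S" for i
        using that assms(4)[OF that] * by (intro Min_antimono) auto
      then show "Min (r ` (\<Union>i\<in>S. T i)) \<le> Min ((\<lambda>i. Min (r ` T i)) ` S)"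
        using fin assms(3) by simp
    qed
    finally show ?thesis using True by (simp add: min_on_apply r_def)
  qed (simp add: min_on_def compose_ops_def)
qed

lemma clone_hom_min_ess:
  assumes "inj q"
  shows "clone_hom (Pol (eq_horn_struct q)) (Pol (above_one_struct q)) (min_ess q)"
proof -
  have pol: "polymorphism (above_one_struct q) n (min_ess q n f)"
    if "polymorphism (eq_horn_struct q) n f" for n f
    unfolding min_ess_def
    by (rule polymorphism_min_on[OF assms ess_args_subset ess_args_nonempty[OF that assms]])
  have proj: "min_ess q n (proj (range q) n i) = proj (range q) n i" if i: "i < n" for n i
  proof (rule ext)
    fix xs show "min_ess q n (proj (range q) n i) xs = proj (range q) n i xs"
    proof (cases "xs \<in> tuples (range q) n")
      case True
      then have "xs ! i \<in> range q" using i by (auto simp: tuples_def subset_iff)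
      moreover have "min_ess q n (proj (range q) n i) xs = q (inv q (xs ! i))"
        using True by (simp add: min_ess_def ess_args_proj[OF assms i] min_on_apply)
      ultimately show ?thesis using True by (simp add: proj_def f_inv_into_f)
    qed (simp add: min_ess_def min_on_def proj_def)
  qed
  have comp: "min_ess q m (compose_ops (range q) m f gs) =
      compose_ops (range q) m (min_ess q n f) (map (min_ess q m) gs)"
    if f: "polymorphism (eq_horn_struct q) n f" and gs: "length gs = n"
      "\<And>g. g \<in> set gs \<Longrightarrow> polymorphism (eq_horn_struct q) m g" for n m f gs
    unfolding min_ess_def[of q m "compose_ops (range q) m f gs"] min_ess_def[of q n f]
  proof (subst ess_args_compose[OF assms f gs], assumption,
      rule min_on_UN[OF assms _ ess_args_nonempty[OF f assms]])
    let ?S = "ess_args (range q) n f"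
    show S: "?S \<subseteq> {..<n}" by (rule ess_args_subset)
    show "finite (ess_args (range q) m (gs ! i)) \<and> ess_args (range q) m (gs ! i) \<noteq> {}" if "i \<in> ?S" for i
      using that S gs ess_args_nonempty[OF gs(2) assms] by (auto simp: finite_ess_args)
    show "map (min_ess q m) gs ! i = min_on q m (ess_args (range q) m (gs ! i))" if "i \<in> ?S" for i
      using that S gs(1) by (auto simp: min_ess_def)
    show "h \<in> tuples (range q) m \<rightarrow> range q" if "h \<in> set (map (min_ess q m) gs)" for h
      using that by (auto simp: min_ess_def min_on_apply)
  qed (use gs(1) in simp)
  show ?thesis
    unfolding clone_hom_def Pol_def
    using pol proj comp by (auto simp: subset_iff)
qed

text \<open>The same two elements serve for every \<open>B'\<close>: by
  \<open>kernel_on_replicate\<close> the values on them determine the essential arguments, which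
  determine \<open>min_ess\<close> everywhere.\<close>

lemma uniformly_cont_min_ess:
  assumes "inj q"
  shows "uniformly_cont (Pol (eq_horn_struct q)) (Pol (above_one_struct q)) (min_ess q)"
  unfolding uniformly_cont_def
proof (intro allI impI exI[of _ "{q 0, q 1}"] conjI ballI)
  show "finite {q 0, q 1}" "{q 0, q 1} \<subseteq> base (Pol (eq_horn_struct q))"
    by (auto simp: Pol_def)
  fix B' n f g xs
  assume "f \<in> ops (Pol (eq_horn_struct q)) n" "g \<in> ops (Pol (eq_horn_struct q)) n"
    and eq: "\<forall>xs\<in>tuples {q 0, q 1} n. f xs = g xs"
  then have "polymorphism (eq_horn_struct q) n f" "polymorphism (eq_horn_struct q) n g"
    by (auto simp: Pol_def)
  note kernel = this[THEN kernel_on_ess_args]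
  have ne: "q 0 \<noteq> q 1" using assms by (simp add: inj_eq)
  have rep: "replicate n (q 0) \<in> tuples {q 0, q 1} n"
    by (intro replicate_in_tuples) simp
  have "i \<in> ess_args (range q) n f \<longleftrightarrow> i \<in> ess_args (range q) n g" if "i < n" for i
    using kernel_on_replicate[OF kernel(1) _ _ ne that] kernel_on_replicate[OF kernel(2) _ _ ne that]
      eq rep list_update_in_tuples[OF rep, of "q 1" i] by simp
  then have "ess_args (range q) n f = ess_args (range q) n g"
    using ess_args_subset[of "range q" n f] ess_args_subset[of "range q" n g] by blast
  then show "min_ess q n f xs = min_ess q n g xs"
    by (simp add: min_ess_def)
qed

theorem theorem1p6:
  fixes q :: "rat \<Rightarrow> 'u"
  assumes "inj q"
  shows "\<not> (\<exists>P :: 'u clone set.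
      (\<forall>\<A> \<in> P. function_clone \<A>) \<and>
      (\<forall>\<A> \<B> \<xi>. \<A> \<in> P \<and> function_clone \<B> \<and> clone_hom \<A> \<B> \<xi> \<and> uniformly_cont \<A> \<B> \<xi> \<longrightarrow> \<B> \<in> P) \<and>
      (\<forall>B :: (nat, 'u) struct. temporal_struct q B \<longrightarrow> (CSP_in_Datalog B \<longleftrightarrow> Pol B \<in> P)))"
proof
  assume "\<exists>P :: 'u clone set.
      (\<forall>\<A> \<in> P. function_clone \<A>) \<and>
      (\<forall>\<A> \<B> \<xi>. \<A> \<in> P \<and> function_clone \<B> \<and> clone_hom \<A> \<B> \<xi> \<and> uniformly_cont \<A> \<B> \<xi> \<longrightarrow> \<B> \<in> P) \<and>
      (\<forall>B :: (nat, 'u) struct. temporal_struct q B \<longrightarrow> (CSP_in_Datalog B \<longleftrightarrow> Pol B \<in> P))"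
  then obtain P :: "'u clone set" where
    closed: "\<And>\<A> \<B> \<xi>. \<A> \<in> P \<Longrightarrow> function_clone \<B> \<Longrightarrow> clone_hom \<A> \<B> \<xi> \<Longrightarrow>
      uniformly_cont \<A> \<B> \<xi> \<Longrightarrow> \<B> \<in> P" and
    captures: "\<And>B :: (nat, 'u) struct. temporal_struct q B \<Longrightarrow> CSP_in_Datalog B \<longleftrightarrow> Pol B \<in> P"
    by blast
  have "Pol (eq_horn_struct q) \<in> P"
    using captures[OF eq_horn_temporal] eq_horn_in_Datalog[OF assms] by blast
  \<comment> \<open>Closure under \<open>min_ess\<close> carries membership from the tractable
    template to the one whose CSP is outside Datalog.\<close>
  then have "Pol (above_one_struct q) \<in> P"
    by (rule closed[OF _ function_clone_Pol clone_hom_min_ess uniformly_cont_min_ess])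
      (use assms above_one_temporal temporal_struct_is_struct in blast)+
  then show False
    using captures[OF above_one_temporal] above_one_not_in_Datalog assms by blast
qed

end
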